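(* For $0<\alpha,\beta\le\frac12$, the limits defining $\Gamma_{\mathrm{odd,S}}(\alpha,\beta)$ and $\Gamma_{\mathrm{odd,B}}(\alpha,\beta)$ exist and \[ \Gamma_{\mathrm{odd,S}}(\alpha,\beta)=\Gamma_{\mathrm{odd,B}}(\alpha,\beta)=\Gamma_{\mathrm{IID}}(\alpha,\beta), \] \[ \max\{\Gamma_{\mathrm{IID}}(\alpha,\beta),\tfrac12\Gamma_{\mathrm{IID}}(2\alpha,\beta)\}\le\underline\Gamma_{\mathrm{even,S}}(\alpha,\beta)\le\overline\Gamma_{\mathrm{even,S}}(\alpha,\beta)\le2\Gamma_{\mathrm{IID}}(\alpha,\beta), \] \[ \Gamma_{\mathrm{IID}}(\alpha,\beta)\le\underline\Gamma_{\mathrm{even,B}}(\alpha,\beta)\le\overline\Gamma_{\mathrm{even,B}}(\alpha,\beta)\le2(1-\beta)\Gamma_{\mathrm{IID}}(\alpha,\beta). \]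
   Context: $d_{\mathrm H}$ is Hamming distance on $\{-1,1\}^n$, $\mathbf 1=(1,\dots,1)$, $S_r=\{\mathbf{x}:d_{\mathrm H}(\mathbf{x},\mathbf 1)=r\}$, $B_r=\{\mathbf{x}:d_{\mathrm H}(\mathbf{x},\mathbf 1)\le r\}$. Let $\mathbf X\sim\mathrm{Unif}\{-1,1\}^n$, $\mathbf Z$ independent of $\mathbf X$, $\mathbf Y=\mathbf X\circ\mathbf Z$ (coordinatewise product). For $f:\{-1,1\}^n\to\mathbb R$: $\mathbf{SStab}_r[f]=\mathbb E[f(\mathbf X)f(\mathbf Y)]$ with $\mathbf Z\sim\mathrm{Unif}(S_r)$; $\mathbf{BStab}_r[f]=\mathbb E[f(\mathbf X)f(\mathbf Y)]$ with $\mathbf Z\sim\mathrm{Unif}(B_r)$; $\mathbf{Stab}_\beta[f]=\mathbb E[f(\mathbf X)f(\mathbf Y)]$ with $\mathbf Z$ having i.i.d. coordinates equal to $-1$ with probability $\beta$ and $1$ with probability $1-\beta$. For $M\in[1:2^n]$ let $\Gamma^{(n)}_{\mathrm S}(M,r)$, $\Gamma^{(n)}_{\mathrm B}(M,r)$, $\Gamma^{(n)}_{\mathrm{IID}}(M,\beta)$ be the maxima of $\mathbf{SStab}_r[f]$, $\mathbf{BStab}_r[f]$, $\mathbf{Stab}_\beta[f]$ respectively over $f:\{-1,1\}^n\to\{0,1\}$ with $\mathbb P[f(\mathbf X)=1]=M/2^n$. Define $\Gamma_{\mathrm{IID}}(\alpha,\beta)=\lim_{n\to\infty}\Gamma^{(n)}_{\mathrm{IID}}(\lfloor\alpha2^n\rfloor,\beta)$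 (this limit exists by monotonicity in $n$); $\Gamma_{\mathrm{odd,S}}(\alpha,\beta)=\lim_{n}\Gamma^{(n)}_{\mathrm S}(\lfloor\alpha2^n\rfloor,2\lfloor\beta n/2\rfloor+1)$; $\overline\Gamma_{\mathrm{even,S}}(\alpha,\beta)=\limsup_n\Gamma^{(n)}_{\mathrm S}(\lfloor\alpha2^n\rfloor,2\lfloor\beta n/2\rfloor)$ and $\underline\Gamma_{\mathrm{even,S}}$ the corresponding $\liminf$; $\Gamma_{\mathrm{odd,B}},\overline\Gamma_{\mathrm{even,B}},\underline\Gamma_{\mathrm{even,B}}$ are defined in the same way with $\Gamma^{(n)}_{\mathrm B}$ in place of $\Gamma^{(n)}_{\mathrm S}$. *)

theory Defs
  imports "HOL-Probability.Probability"
begin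

text \<open>
  Points of the cube are extensional functions on \<open>{..<n}\<close> (undefined outside),
  so that the cube is a finite set for every \<open>n\<close>.
\<close>

definition cube :: "nat \<Rightarrow> (nat \<Rightarrow> int) set" where
  "cube n = ({..<n} \<rightarrow>\<^sub>E {-1, 1})"

definition ones :: "nat \<Rightarrow> nat \<Rightarrow> int" where
  "ones n = (\<lambda>i\<in>{..<n}. 1)"

definition hamming :: "nat \<Rightarrow> (nat \<Rightarrow> int) \<Rightarrow> (nat \<Rightarrow> int) \<Rightarrow> nat" where
  "hamming n x y = card {i\<in>{..<n}. x i \<noteq> y i}"

definition coord_prod :: "nat \<Rightarrow> (nat \<Rightarrow> int) \<Rightarrow> (nat \<Rightarrow> int) \<Rightarrow> nat \<Rightarrow> int" where
  "coord_prod n x z = (\<lambda>i\<in>{..<n}. x i * z i)"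

definition hsphere :: "nat \<Rightarrow> nat \<Rightarrow> (nat \<Rightarrow> int) set" where
  "hsphere n r = {x \<in> cube n. hamming n x (ones n) = r}"

definition hball :: "nat \<Rightarrow> nat \<Rightarrow> (nat \<Rightarrow> int) set" where
  "hball n r = {x \<in> cube n. hamming n x (ones n) \<le> r}"

definition iid_noise :: "nat \<Rightarrow> real \<Rightarrow> (nat \<Rightarrow> int) pmf" where
  "iid_noise n \<beta> =
     Pi_pmf {..<n} undefined (\<lambda>_. map_pmf (\<lambda>b. if b then -1 else 1) (bernoulli_pmf \<beta>))"

text \<open>
  The expectation of \<open>f(X) f(X \<circ> Z)\<close> for \<open>X\<close> uniform on the cube and \<open>Z\<close>,
  with distribution \<open>\<zeta>\<close>, independent of \<open>X\<close>.
\<close>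

definition noise_stab :: "nat \<Rightarrow> (nat \<Rightarrow> int) pmf \<Rightarrow> ((nat \<Rightarrow> int) \<Rightarrow> real) \<Rightarrow> real" where
  "noise_stab n \<zeta> f =
     measure_pmf.expectation (pair_pmf (pmf_of_set (cube n)) \<zeta>)
       (\<lambda>(x, z). f x * f (coord_prod n x z))"

definition SStab :: "nat \<Rightarrow> nat \<Rightarrow> ((nat \<Rightarrow> int) \<Rightarrow> real) \<Rightarrow> real" where
  "SStab n r f = noise_stab n (pmf_of_set (hsphere n r)) f"

definition BStab :: "nat \<Rightarrow> nat \<Rightarrow> ((nat \<Rightarrow> int) \<Rightarrow> real) \<Rightarrow> real" where
  "BStab n r f = noise_stab n (pmf_of_set (hball n r)) f"

definition Stab :: "nat \<Rightarrow> real \<Rightarrow> ((nat \<Rightarrow> int) \<Rightarrow> real) \<Rightarrow> real" where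
  "Stab n \<beta> f = noise_stab n (iid_noise n \<beta>) f"

definition bool_funs :: "nat \<Rightarrow> nat \<Rightarrow> ((nat \<Rightarrow> int) \<Rightarrow> real) set" where
  "bool_funs n M =
     {f \<in> cube n \<rightarrow>\<^sub>E {0, 1}.
        measure_pmf.prob (pmf_of_set (cube n)) {x. f x = 1} = real M / 2 ^ n}"

definition GammaN_S :: "nat \<Rightarrow> nat \<Rightarrow> nat \<Rightarrow> real" where
  "GammaN_S n M r = Max (SStab n r ` bool_funs n M)"

definition GammaN_B :: "nat \<Rightarrow> nat \<Rightarrow> nat \<Rightarrow> real" where
  "GammaN_B n M r = Max (BStab n r ` bool_funs n M)"

definition GammaN_IID :: "nat \<Rightarrow> nat \<Rightarrow> real \<Rightarrow> real" where
  "GammaN_IID n M \<beta> = Max (Stab n \<beta> ` bool_funs n M)"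

definition vol :: "real \<Rightarrow> nat \<Rightarrow> nat" where
  "vol \<alpha> n = nat \<lfloor>\<alpha> * 2 ^ n\<rfloor>"

definition even_radius :: "real \<Rightarrow> nat \<Rightarrow> nat" where
  "even_radius \<beta> n = 2 * nat \<lfloor>\<beta> * real n / 2\<rfloor>"

definition odd_radius :: "real \<Rightarrow> nat \<Rightarrow> nat" where
  "odd_radius \<beta> n = 2 * nat \<lfloor>\<beta> * real n / 2\<rfloor> + 1"

definition Gamma_IID :: "real \<Rightarrow> real \<Rightarrow> real" where
  "Gamma_IID \<alpha> \<beta> = lim (\<lambda>n. GammaN_IID n (vol \<alpha> n) \<beta>)"

definition Gamma_odd_S :: "real \<Rightarrow> real \<Rightarrow> real" where
  "Gamma_odd_S \<alpha> \<beta> = lim (\<lambda>n. GammaN_S n (vol \<alpha> n) (odd_radius \<beta> n))"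

definition Gamma_odd_B :: "real \<Rightarrow> real \<Rightarrow> real" where
  "Gamma_odd_B \<alpha> \<beta> = lim (\<lambda>n. GammaN_B n (vol \<alpha> n) (odd_radius \<beta> n))"

text \<open>Upper and lower limits are taken in \<open>ereal\<close>, where they exist unconditionally.\<close>

definition Gamma_even_S_upper :: "real \<Rightarrow> real \<Rightarrow> ereal" where
  "Gamma_even_S_upper \<alpha> \<beta> = limsup (\<lambda>n. ereal (GammaN_S n (vol \<alpha> n) (even_radius \<beta> n)))"

definition Gamma_even_S_lower :: "real \<Rightarrow> real \<Rightarrow> ereal" where
  "Gamma_even_S_lower \<alpha> \<beta> = liminf (\<lambda>n. ereal (GammaN_S n (vol \<alpha> n) (even_radius \<beta> n)))"

definition Gamma_even_B_upper :: "real \<Rightarrow> real \<Rightarrow> ereal" where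
  "Gamma_even_B_upper \<alpha> \<beta> = limsup (\<lambda>n. ereal (GammaN_B n (vol \<alpha> n) (even_radius \<beta> n)))"

definition Gamma_even_B_lower :: "real \<Rightarrow> real \<Rightarrow> ereal" where
  "Gamma_even_B_lower \<alpha> \<beta> = liminf (\<lambda>n. ereal (GammaN_B n (vol \<alpha> n) (even_radius \<beta> n)))"

end

theory Submission
  imports Defs "HOL-Real_Asymp.Real_Asymp"
begin

text \<open>
  Expand in characters: \<open>E f(X) f(X \<circ> Z) = \<Sum>\<^sub>S f^(S)\<^sup>2 E \<chi>\<^sub>S(Z)\<close>. For \<open>Z\<close> uniform on a sphere or a ball the
  coordinates are exchangeable, so \<open>E \<chi>\<^sub>S(Z)\<close> depends on \<open>card S\<close> only. Put \<open>b = 1 - 2 \<beta>\<close>. Since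
  the mean of the coordinates of \<open>Z\<close> concentrates at \<open>b\<close>, multiplying \<open>\<chi>\<^sub>S\<close> by that mean shows that
  \<open>E \<chi>\<^sub>S(Z)\<close> is close to \<open>b ^ card S\<close> for bounded \<open>card S\<close>, and close to \<open>c b ^ (n - card S)\<close> for bounded
  \<open>n - card S\<close>, where \<open>c = E \<chi>\<^sub>[\<^sub>n\<^sub>](Z)\<close>; a second moment estimate makes it small for all other \<open>S\<close>.
  Hence, uniformly in Boolean \<open>f\<close>,

    \<open>E f(X) f(X \<circ> Z) = Stab\<^sub>\<beta>[f] + c Stab\<^sub>\<beta>[f \<chi>\<^sub>[\<^sub>n\<^sub>]] + o(1)\<close>,

  and \<open>0 \<le> Stab\<^sub>\<beta>[f \<chi>\<^sub>[\<^sub>n\<^sub>]] \<le> Stab\<^sub>\<beta>[f]\<close>. For a sphere \<open>c = (-1) ^ r\<close>; for a ball \<open>c\<close> tends to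
  \<open>(1 - 2 \<beta>) (-1) ^ r\<close>. This gives the upper bounds. For the lower bounds take \<open>f\<close> depending on a bounded
  number of coordinates, which makes \<open>Stab\<^sub>\<beta>[f \<chi>\<^sub>[\<^sub>n\<^sub>]]\<close> vanish in the limit, or the restriction of such an
  \<open>f\<close> to the points of even parity.
\<close>

section \<open>Fourier analysis on the cube\<close>

definition chi :: "nat set \<Rightarrow> (nat \<Rightarrow> int) \<Rightarrow> real" where
  "chi S x = (\<Prod>i\<in>S. real_of_int (x i))"

definition fourier :: "nat \<Rightarrow> ((nat \<Rightarrow> int) \<Rightarrow> real) \<Rightarrow> nat set \<Rightarrow> real" where
  "fourier n f S = (\<Sum>x\<in>cube n. f x * chi S x) / 2 ^ n"

lemma finite_cube [simp]: "finite (cube n)"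
  unfolding cube_def by (intro finite_PiE) auto

lemma card_cube [simp]: "card (cube n) = 2 ^ n"
  unfolding cube_def by (simp add: card_PiE numeral_2_eq_2)

lemma cube_nonempty [simp]: "cube n \<noteq> {}"
  using card_cube[of n] by (metis card.empty power_not_zero zero_neq_numeral)

lemma cube_values: "x \<in> cube n \<Longrightarrow> i < n \<Longrightarrow> x i = -1 \<or> x i = 1"
  unfolding cube_def by auto

lemma cube_square: "x \<in> cube n \<Longrightarrow> i < n \<Longrightarrow> x i * x i = 1"
  using cube_values[of x n i] by auto

lemma cube_ext: "x \<in> cube n \<Longrightarrow> y \<in> cube n \<Longrightarrow> (\<And>i. i < n \<Longrightarrow> x i = y i) \<Longrightarrow> x = y"
  unfolding cube_def by (rule PiE_ext) auto

lemma coord_prod_in_cube: "x \<in> cube n \<Longrightarrow> z \<in> cube n \<Longrightarrow> coord_prod n x z \<in> cube n"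
  using cube_values[of x n] cube_values[of z n] by (fastforce simp: cube_def coord_prod_def)

lemma chi_cases:
  assumes "x \<in> cube n" "S \<subseteq> {..<n}"
  shows "chi S x = 1 \<or> chi S x = -1"
proof -
  have "finite S" using assms finite_subset by blast
  then show ?thesis using assms(2)
  proof induction
    case (insert i F)
    then show ?case using cube_values[OF assms(1), of i] by (auto simp: chi_def)
  qed (simp add: chi_def)
qed

lemma abs_chi: "x \<in> cube n \<Longrightarrow> S \<subseteq> {..<n} \<Longrightarrow> \<bar>chi S x\<bar> = 1"
  using chi_cases[of x n S] by auto

lemma chi_square: "x \<in> cube n \<Longrightarrow> S \<subseteq> {..<n} \<Longrightarrow> chi S x * chi S x = 1"
  using chi_cases[of x n S] by auto

lemma chi_empty [simp]: "chi {} x = 1"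
  by (simp add: chi_def)

lemma chi_coord_prod: "S \<subseteq> {..<n} \<Longrightarrow> chi S (coord_prod n x z) = chi S x * chi S z"
  unfolding chi_def coord_prod_def prod.distrib[symmetric] by (intro prod.cong) auto

lemma chi_union_disjoint:
  "finite S \<Longrightarrow> finite T \<Longrightarrow> S \<inter> T = {} \<Longrightarrow> chi (S \<union> T) x = chi S x * chi T x"
  unfolding chi_def by (rule prod.union_disjoint)

text \<open>On the cube every character is its own inverse, so multiplication by the parity
  character exchanges a set with its complement. This symmetry is the source of the second main
  term.\<close>

lemma chi_complement:
  assumes "x \<in> cube n" "S \<subseteq> {..<n}"
  shows "chi ({..<n} - S) x = chi {..<n} x * chi S x"
proof -
  have "chi {..<n} x = chi ({..<n} - S) x * chi S x"
    using chi_union_disjoint[of "{..<n} - S" S x] assms(2) finite_subset[OF assms(2)]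
    by (simp add: Un_absorb2 Diff_disjoint Int_commute)
  then show ?thesis using chi_square[OF assms] by simp
qed

text \<open>The sum is the expanded product of the factors \<open>1 + w i\<close>, one of which
  vanishes as soon as some coordinate is -1. This is orthogonality of the characters, summed over
  index sets.\<close>

lemma sum_chi_Pow:
  assumes "w \<in> cube n"
  shows "(\<Sum>S\<in>Pow {..<n}. chi S w) = (if w = ones n then 2 ^ n else 0)"
proof -
  have "(\<Sum>S\<in>Pow {..<n}. chi S w) = (\<Prod>i<n. 1 + real_of_int (w i))"
    unfolding chi_def
    using prod_add[of "{..<n}" "\<lambda>i. real_of_int (w i)" "\<lambda>_. 1"]
    by (simp add: add.commute)
  also have "\<dots> = (if w = ones n then 2 ^ n else 0)"
  proof (cases "w = ones n")
    case True
    then show ?thesis by (simp add: ones_def)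
  next
    case False
    have "ones n \<in> cube n" by (auto simp: ones_def cube_def)
    then obtain i where "i < n" "w i \<noteq> 1"
      using False cube_ext[OF assms, of "ones n"] by (auto simp: ones_def)
    then have "w i = -1" using cube_values[OF assms] by auto
    then have "\<exists>i\<in>{..<n}. 1 + real_of_int (w i) = 0" using \<open>i < n\<close> by force
    then show ?thesis using False by simp
  qed
  finally show ?thesis .
qed

lemma coord_prod_eq_ones_iff:
  assumes "x \<in> cube n" "y \<in> cube n" "z \<in> cube n"
  shows "coord_prod n (coord_prod n x y) z = ones n \<longleftrightarrow> y = coord_prod n x z"
proof
  assume L: "coord_prod n (coord_prod n x y) z = ones n"
  show "y = coord_prod n x z"
  proof (rule cube_ext[OF assms(2) coord_prod_in_cube[OF assms(1,3)]])
    fix i assume i: "i < n"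
    have "x i * y i * z i = 1"
      using fun_cong[OF L, of i] i by (simp add: coord_prod_def ones_def)
    then show "y i = coord_prod n x z i"
      using i cube_values[OF assms(1) i] cube_values[OF assms(2) i] cube_values[OF assms(3) i]
      by (auto simp: coord_prod_def)
  qed
next
  assume "y = coord_prod n x z"
  then show "coord_prod n (coord_prod n x y) z = ones n"
    using cube_square[OF assms(1)] cube_square[OF assms(3)]
    by (auto simp: coord_prod_def ones_def fun_eq_iff mult.assoc mult.left_commute)
qed

text \<open>A squared coefficient is a double sum over \<open>x\<close> and \<open>y\<close>, and
  its characters combine with that of \<open>z\<close> into one character at the product of all
  three points. Summing over \<open>S\<close> first leaves only the pairs where \<open>y\<close> is
  the product of \<open>x\<close> and \<open>z\<close>.\<close>

lemma autocorrelation_fourier: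
  assumes "z \<in> cube n"
  shows "(\<Sum>x\<in>cube n. f x * f (coord_prod n x z)) / 2 ^ n =
    (\<Sum>S\<in>Pow {..<n}. (fourier n f S)\<^sup>2 * chi S z)"
proof -
  have "(\<Sum>S\<in>Pow {..<n}. (fourier n f S)\<^sup>2 * chi S z) =
     (\<Sum>S\<in>Pow {..<n}. \<Sum>x\<in>cube n. \<Sum>y\<in>cube n.
        f x * f y * chi S (coord_prod n (coord_prod n x y) z) / (2 ^ n * 2 ^ n))"
  proof (intro sum.cong refl)
    fix S assume S: "S \<in> Pow {..<n}"
    have *: "(fourier n f S)\<^sup>2 * chi S z =
        (\<Sum>x\<in>cube n. f x * chi S x) * (\<Sum>y\<in>cube n. f y * chi S y) * (chi S z / (2 ^ n * 2 ^ n))"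
      by (simp add: fourier_def power2_eq_square)
    show "(fourier n f S)\<^sup>2 * chi S z = (\<Sum>x\<in>cube n. \<Sum>y\<in>cube n.
        f x * f y * chi S (coord_prod n (coord_prod n x y) z) / (2 ^ n * 2 ^ n))"
      unfolding * sum_product unfolding sum_distrib_right
      using S by (intro sum.cong refl) (simp add: chi_coord_prod mult_ac)
  qed
  also have "\<dots> = (\<Sum>x\<in>cube n. \<Sum>y\<in>cube n. f x * f y *
       (\<Sum>S\<in>Pow {..<n}. chi S (coord_prod n (coord_prod n x y) z)) / (2 ^ n * 2 ^ n))"
    by (subst sum.swap, rule sum.cong[OF refl], subst sum.swap)
       (simp add: sum_distrib_left sum_divide_distrib)
  also have "\<dots> = (\<Sum>x\<in>cube n. \<Sum>y\<in>cube n. if y = coord_prod n x z then f x * f y / 2 ^ n else 0)"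
    by (intro sum.cong refl)
       (simp add: sum_chi_Pow coord_prod_in_cube assms coord_prod_eq_ones_iff)
  also have "\<dots> = (\<Sum>x\<in>cube n. f x * f (coord_prod n x z) / 2 ^ n)"
    by (intro sum.cong refl) (simp add: coord_prod_in_cube assms)
  finally show ?thesis by (simp add: sum_divide_distrib)
qed

text \<open>This is the case \<open>z = ones n\<close> of
  \<open>autocorrelation_fourier\<close>.\<close>

lemma parseval:
  "(\<Sum>S\<in>Pow {..<n}. (fourier n f S)\<^sup>2) = (\<Sum>x\<in>cube n. (f x)\<^sup>2) / 2 ^ n"
proof -
  have ones: "ones n \<in> cube n" by (auto simp: ones_def cube_def)
  have "coord_prod n x (ones n) = x" if "x \<in> cube n" for x
    using that by (intro cube_ext[of _ n] coord_prod_in_cube ones) (auto simp: coord_prod_def ones_def)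
  moreover have "chi S (ones n) = 1" if "S \<subseteq> {..<n}" for S
    using that unfolding chi_def ones_def by (intro prod.neutral) auto
  ultimately show ?thesis
    using autocorrelation_fourier[OF ones, of f] by (simp add: power2_eq_square)
qed

lemma fourier_mult_chi_full:
  assumes "S \<subseteq> {..<n}"
  shows "fourier n (\<lambda>x. f x * chi {..<n} x) S = fourier n f ({..<n} - S)"
  unfolding fourier_def using chi_complement[OF _ assms] by (simp add: mult.assoc)

section \<open>Noise stability in terms of Fourier coefficients\<close>

lemma expectation_cube:
  fixes g :: "_ \<Rightarrow> real"
  assumes "set_pmf \<zeta> \<subseteq> cube n"
  shows "measure_pmf.expectation \<zeta> g = (\<Sum>z\<in>cube n. pmf \<zeta> z * g z)"
  using integral_measure_pmf[of "cube n" \<zeta> g] assms by auto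

lemma noise_stab_sum:
  assumes "set_pmf \<zeta> \<subseteq> cube n"
  shows "noise_stab n \<zeta> f =
    (\<Sum>z\<in>cube n. pmf \<zeta> z * ((\<Sum>x\<in>cube n. f x * f (coord_prod n x z)) / 2 ^ n))"
proof -
  have "noise_stab n \<zeta> f = (\<Sum>a\<in>cube n \<times> cube n.
      pmf (pair_pmf (pmf_of_set (cube n)) \<zeta>) a *\<^sub>R (case a of (x, z) \<Rightarrow> f x * f (coord_prod n x z)))"
    unfolding noise_stab_def
    by (rule integral_measure_pmf) (use assms in auto)
  also have "\<dots> = (\<Sum>x\<in>cube n. \<Sum>z\<in>cube n. pmf \<zeta> z * (f x * f (coord_prod n x z)) / 2 ^ n)"
    by (simp add: sum.cartesian_product' pmf_pair mult_ac)
  also have "\<dots> = (\<Sum>z\<in>cube n. \<Sum>x\<in>cube n. pmf \<zeta> z * (f x * f (coord_prod n x z)) / 2 ^ n)"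
    by (rule sum.swap)
  finally show ?thesis by (simp add: sum_distrib_left sum_divide_distrib)
qed

lemma noise_stab_fourier:
  assumes "set_pmf \<zeta> \<subseteq> cube n"
  shows "noise_stab n \<zeta> f =
    (\<Sum>S\<in>Pow {..<n}. (fourier n f S)\<^sup>2 * measure_pmf.expectation \<zeta> (chi S))"
proof -
  have "noise_stab n \<zeta> f =
      (\<Sum>z\<in>cube n. \<Sum>S\<in>Pow {..<n}. (fourier n f S)\<^sup>2 * (pmf \<zeta> z * chi S z))"
    unfolding noise_stab_sum[OF assms]
    by (intro sum.cong refl) (simp add: autocorrelation_fourier sum_distrib_left mult_ac)
  also have "\<dots> = (\<Sum>S\<in>Pow {..<n}. \<Sum>z\<in>cube n. (fourier n f S)\<^sup>2 * (pmf \<zeta> z * chi S z))"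
    by (rule sum.swap)
  finally show ?thesis by (simp add: expectation_cube[OF assms] sum_distrib_left)
qed

lemma noise_stab_cong:
  assumes "set_pmf \<zeta> \<subseteq> cube n" "\<And>x. x \<in> cube n \<Longrightarrow> f x = g x"
  shows "noise_stab n \<zeta> f = noise_stab n \<zeta> g"
  unfolding noise_stab_sum[OF assms(1)]
  by (intro sum.cong refl arg_cong2[where f = "(*)"] arg_cong2[where f = "(/)"])
     (simp_all add: assms(2) coord_prod_in_cube)

text \<open>The hypothesis bounds the absolute value of \<open>f\<close>, so that the lemma compares
  not only indicators of nested sets but also an indicator times a character with the indicator
  itself.\<close>

lemma noise_stab_mono:
  assumes "set_pmf \<zeta> \<subseteq> cube n" "\<And>x. x \<in> cube n \<Longrightarrow> \<bar>f x\<bar> \<le> g x"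
  shows "noise_stab n \<zeta> f \<le> noise_stab n \<zeta> g"
  unfolding noise_stab_sum[OF assms(1)]
proof (intro sum_mono mult_left_mono divide_right_mono)
  fix z x assume z: "z \<in> cube n" and x: "x \<in> cube n"
  have "f x * f (coord_prod n x z) \<le> \<bar>f x\<bar> * \<bar>f (coord_prod n x z)\<bar>"
    by (metis abs_ge_self abs_mult)
  also have "\<dots> \<le> g x * g (coord_prod n x z)"
    using assms(2)[OF x] assms(2)[OF coord_prod_in_cube[OF x z]] by (intro mult_mono) auto
  finally show "f x * f (coord_prod n x z) \<le> g x * g (coord_prod n x z)" .
qed auto

lemma set_pmf_iid_noise: "set_pmf (iid_noise n \<beta>) \<subseteq> cube n"
proof -
  have "set_pmf (iid_noise n \<beta>) \<subseteq>
      PiE_dflt {..<n} undefined (\<lambda>_. set_pmf (map_pmf (\<lambda>b. if b then -1 else 1) (bernoulli_pmf \<beta>)))"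
    unfolding iid_noise_def
    by (rule order.trans[OF set_Pi_pmf_subset']) (simp_all only: comp_def finite_lessThan order.refl)
  also have "\<dots> \<subseteq> cube n"
    by (auto simp: PiE_dflt_def cube_def PiE_def Pi_def extensional_def split: if_splits)
  finally show ?thesis .
qed

text \<open>By independence the expectation factorises over the coordinates
  (\<open>prod_sum_PiE\<close>), and a coordinate of the noise has mean
  \<open>1 - 2 * \<beta>\<close>.\<close>

lemma expectation_chi_iid_noise:
  assumes "0 \<le> \<beta>" "\<beta> \<le> 1" "S \<subseteq> {..<n}"
  shows "measure_pmf.expectation (iid_noise n \<beta>) (chi S) = (1 - 2 * \<beta>) ^ card S"
proof -
  let ?h = "\<lambda>b. if b then -1 else 1 :: int"
  let ?g = "\<lambda>i v. if i \<in> S then real_of_int v else 1"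
  have "inj ?h" by (auto simp: inj_def)
  then have p: "pmf (map_pmf ?h (bernoulli_pmf \<beta>)) (-1) = \<beta>"
    "pmf (map_pmf ?h (bernoulli_pmf \<beta>)) 1 = 1 - \<beta>"
    using pmf_map_inj'[of ?h "bernoulli_pmf \<beta>" True] pmf_map_inj'[of ?h "bernoulli_pmf \<beta>" False]
      assms by auto
  have chi: "chi S x = (\<Prod>i<n. ?g i (x i))" for x
    using assms(3) by (simp add: chi_def prod.inter_restrict[symmetric] Int_absorb1)
  have "measure_pmf.expectation (iid_noise n \<beta>) (chi S) =
      (\<Sum>z\<in>cube n. \<Prod>i<n. pmf (map_pmf ?h (bernoulli_pmf \<beta>)) (z i) * ?g i (z i))"
    unfolding expectation_cube[OF set_pmf_iid_noise] unfolding iid_noise_def prod.distrib chi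
    by (intro sum.cong refl arg_cong2[where f = "(*)"] pmf_Pi') (auto simp: cube_def)
  also have "\<dots> = (\<Prod>i<n. \<Sum>v\<in>{-1, 1}. pmf (map_pmf ?h (bernoulli_pmf \<beta>)) v * ?g i v)"
    unfolding cube_def by (rule prod_sum_PiE[symmetric]) auto
  also have "\<dots> = (\<Prod>i<n. if i \<in> S then 1 - 2 * \<beta> else 1)"
    by (intro prod.cong refl) (simp add: p)
  also have "\<dots> = (1 - 2 * \<beta>) ^ card S"
    using assms(3) by (simp add: prod.inter_restrict[symmetric] Int_absorb1)
  finally show ?thesis .
qed

lemma Stab_fourier:
  assumes "0 \<le> \<beta>" "\<beta> \<le> 1"
  shows "Stab n \<beta> f = (\<Sum>S\<in>Pow {..<n}. (fourier n f S)\<^sup>2 * (1 - 2 * \<beta>) ^ card S)"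
  unfolding Stab_def noise_stab_fourier[OF set_pmf_iid_noise]
  by (intro sum.cong refl) (simp add: expectation_chi_iid_noise assms)

text \<open>Multiplication by the parity character moves each coefficient to the complementary set,
  so the sum is reindexed by complementation.\<close>

lemma Stab_mult_chi_full_fourier:
  assumes "0 \<le> \<beta>" "\<beta> \<le> 1"
  shows "Stab n \<beta> (\<lambda>x. f x * chi {..<n} x) =
    (\<Sum>S\<in>Pow {..<n}. (fourier n f S)\<^sup>2 * (1 - 2 * \<beta>) ^ (n - card S))"
proof -
  have "Stab n \<beta> (\<lambda>x. f x * chi {..<n} x) =
      (\<Sum>S\<in>Pow {..<n}. (fourier n f ({..<n} - S))\<^sup>2 * (1 - 2 * \<beta>) ^ card S)"
    unfolding Stab_fourier[OF assms] by (intro sum.cong refl) (simp add: fourier_mult_chi_full)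
  also have "\<dots> = (\<Sum>S\<in>Pow {..<n}. (fourier n f S)\<^sup>2 * (1 - 2 * \<beta>) ^ (n - card S))"
    by (rule sum.reindex_bij_witness[where i = "\<lambda>S. {..<n} - S" and j = "\<lambda>S. {..<n} - S"])
       (auto simp: card_Diff_subset finite_subset double_diff subset_eq_atLeast0_lessThan_card
          lessThan_atLeast0)
  finally show ?thesis .
qed

section \<open>Exchangeable noise\<close>

text \<open>The support condition turns all expectations into finite sums over the cube. A
  permutation of \<open>{..<n}\<close> fixes every other index, so composing with it preserves
  extensionality.\<close>

definition exchangeable :: "nat \<Rightarrow> (nat \<Rightarrow> int) pmf \<Rightarrow> bool" where
  "exchangeable n \<zeta> \<longleftrightarrow> set_pmf \<zeta> \<subseteq> cube n \<and>
     (\<forall>\<pi> z. \<pi> permutes {..<n} \<longrightarrow> pmf \<zeta> (z \<circ> \<pi>) = pmf \<zeta> z)"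

abbreviation chi_mean :: "(nat \<Rightarrow> int) pmf \<Rightarrow> nat set \<Rightarrow> real" where
  "chi_mean \<zeta> S \<equiv> measure_pmf.expectation \<zeta> (chi S)"

text \<open>The first absolute moment suffices: characters have absolute value 1, so it directly
  bounds the error made when the coordinate mean next to a character is replaced by
  \<open>b\<close>.\<close>

definition mean_deviation :: "nat \<Rightarrow> (nat \<Rightarrow> int) pmf \<Rightarrow> real \<Rightarrow> real" where
  "mean_deviation n \<zeta> b =
     measure_pmf.expectation \<zeta> (\<lambda>z. \<bar>(\<Sum>i<n. real_of_int (z i)) / real n - b\<bar>)"

lemma exchangeable_support: "exchangeable n \<zeta> \<Longrightarrow> set_pmf \<zeta> \<subseteq> cube n"
  by (simp add: exchangeable_def)

lemma integrable_cube_support: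
  fixes g :: "_ \<Rightarrow> real"
  assumes "set_pmf \<zeta> \<subseteq> cube n"
  shows "integrable \<zeta> g"
  using assms by (intro integrable_measure_pmf_finite finite_subset[OF assms]) auto

lemma expectation_abs_le:
  fixes g h :: "_ \<Rightarrow> real"
  assumes "set_pmf \<zeta> \<subseteq> cube n" "\<And>z. z \<in> cube n \<Longrightarrow> \<bar>g z\<bar> \<le> h z"
  shows "\<bar>measure_pmf.expectation \<zeta> g\<bar> \<le> measure_pmf.expectation \<zeta> h"
  unfolding expectation_cube[OF assms(1)]
  by (rule order.trans[OF sum_abs]) (auto intro!: sum_mono mult_left_mono assms(2) simp: abs_mult)

lemma abs_chi_mean_le_1:
  assumes "set_pmf \<zeta> \<subseteq> cube n" "S \<subseteq> {..<n}"
  shows "\<bar>chi_mean \<zeta> S\<bar> \<le> 1"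
  using expectation_abs_le[OF assms(1), of "chi S" "\<lambda>_. 1"] abs_chi[OF _ assms(2)] by simp

section \<open>Means of characters under exchangeable noise\<close>

text \<open>A bijection from \<open>S\<close> to \<open>T\<close> is glued to one between their
  complements in \<open>U\<close>, and to the identity outside \<open>U\<close>.\<close>

lemma exists_permutes_image:
  assumes "finite U" "S \<subseteq> U" "T \<subseteq> U" "card S = card T"
  shows "\<exists>\<pi>. \<pi> permutes U \<and> \<pi> ` S = T"
proof -
  have fin: "finite S" "finite T" using assms finite_subset by auto
  obtain p where p: "bij_betw p S T"
    using finite_same_card_bij[OF fin assms(4)] by blast
  have "card (U - S) = card (U - T)" using assms fin by (simp add: card_Diff_subset)
  then obtain q where q: "bij_betw q (U - S) (U - T)"
    using finite_same_card_bij[of "U - S" "U - T"] assms(1) by auto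
  define \<pi> where "\<pi> = (\<lambda>x. if x \<in> S then p x else if x \<in> U then q x else x)"
  have 1: "bij_betw \<pi> S T"
    using p by (rule bij_betw_cong[THEN iffD1, rotated]) (auto simp: \<pi>_def)
  have 2: "bij_betw \<pi> (U - S) (U - T)"
    using q by (rule bij_betw_cong[THEN iffD1, rotated]) (auto simp: \<pi>_def)
  have "bij_betw \<pi> (S \<union> (U - S)) (T \<union> (U - T))"
    by (rule bij_betw_combine[OF 1 2]) auto
  then have "bij_betw \<pi> U U" using assms(2,3) by (simp add: Un_absorb1)
  then have "\<pi> permutes U"
    by (rule bij_imp_permutes) (use assms(2) in \<open>auto simp: \<pi>_def\<close>)
  then show ?thesis using 1 by (auto simp: bij_betw_def)
qed

lemma comp_permutes_in_cube:
  assumes "\<pi> permutes {..<n}" "z \<in> cube n"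
  shows "z \<circ> \<pi> \<in> cube n"
proof -
  have "\<pi> i < n \<longleftrightarrow> i < n" for i using permutes_in_image[OF assms(1), of i] by simp
  then show ?thesis using assms(2)
    by (auto simp: cube_def PiE_def Pi_def extensional_def)
qed

text \<open>A permutation carrying \<open>S\<close> to \<open>T\<close> turns the character of
  \<open>S\<close> into that of \<open>T\<close> and preserves the distribution, so it gives a
  change of variables in the sum over the cube.\<close>

lemma chi_mean_eq:
  assumes "exchangeable n \<zeta>" "S \<subseteq> {..<n}" "T \<subseteq> {..<n}" "card S = card T"
  shows "chi_mean \<zeta> S = chi_mean \<zeta> T"
proof -
  note supp = exchangeable_support[OF assms(1)]
  obtain \<pi> where \<pi>: "\<pi> permutes {..<n}" "\<pi> ` S = T"
    using exists_permutes_image[OF _ assms(2-4)] by auto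
  have chi: "chi S (z \<circ> \<pi>) = chi T z" for z
    unfolding chi_def \<pi>(2)[symmetric]
    by (subst prod.reindex) (use permutes_inj_on[OF \<pi>(1)] in auto)
  have "bij_betw (\<lambda>z. z \<circ> \<pi>) (cube n) (cube n)"
  proof (rule bij_betwI[where g = "\<lambda>z. z \<circ> inv_into UNIV \<pi>"])
    show "(z \<circ> \<pi>) \<circ> inv_into UNIV \<pi> = z" for z
      unfolding comp_assoc permutes_inv_o(1)[OF \<pi>(1)] by simp
    show "(z \<circ> inv_into UNIV \<pi>) \<circ> \<pi> = z" for z
      unfolding comp_assoc permutes_inv_o(2)[OF \<pi>(1)] by simp
  qed (use comp_permutes_in_cube \<pi>(1) permutes_inv[OF \<pi>(1)] in blast)+
  then have "chi_mean \<zeta> S = (\<Sum>z\<in>cube n. pmf \<zeta> (z \<circ> \<pi>) * chi S (z \<circ> \<pi>))"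
    unfolding expectation_cube[OF supp] by (rule sum.reindex_bij_betw[symmetric])
  also have "\<dots> = chi_mean \<zeta> T"
    unfolding expectation_cube[OF supp] chi
    using assms(1) \<pi>(1) by (simp add: exchangeable_def)
  finally show ?thesis .
qed

lemma chi_insert: "finite S \<Longrightarrow> i \<notin> S \<Longrightarrow> chi (insert i S) z = chi S z * real_of_int (z i)"
  by (simp add: chi_def mult.commute)

lemma chi_remove:
  assumes "z \<in> cube n" "i < n" "finite S" "i \<in> S"
  shows "chi (S - {i}) z = chi S z * real_of_int (z i)"
proof -
  have "chi S z = chi (S - {i}) z * real_of_int (z i)"
    using chi_insert[of "S - {i}" i z] assms by (simp add: insert_absorb)
  moreover have "real_of_int (z i) * real_of_int (z i) = 1"
    using cube_values[OF assms(1,2)] by auto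
  ultimately show ?thesis by (simp add: mult.assoc)
qed

text \<open>The mean \<open>m\<close> of the character times the coordinate average is estimated
  twice. Expanding the average gives \<open>t\<close>, up to the exceptional indices in
  \<open>R\<close>, each costing at most \<open>2 / n\<close>. Replacing the average by
  \<open>b\<close> costs at most the mean deviation.\<close>

lemma chi_mean_step:
  assumes supp: "set_pmf \<zeta> \<subseteq> cube n" and "n > 0" "S \<subseteq> {..<n}" "R \<subseteq> {..<n}" "\<bar>t\<bar> \<le> 1"
    and t: "\<And>i. i < n \<Longrightarrow> i \<notin> R \<Longrightarrow>
      measure_pmf.expectation \<zeta> (\<lambda>z. chi S z * real_of_int (z i)) = t"
  shows "\<bar>t - b * chi_mean \<zeta> S\<bar> \<le> mean_deviation n \<zeta> b + 2 * real (card R) / real n"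
proof -
  let ?E = "measure_pmf.expectation \<zeta>"
  define m where "m = ?E (\<lambda>z. chi S z * ((\<Sum>i<n. real_of_int (z i)) / real n))"
  note int = integrable_cube_support[OF supp]
  have "m = (\<Sum>i<n. ?E (\<lambda>z. chi S z * real_of_int (z i))) / real n"
    unfolding m_def by (simp add: sum_distrib_left int)
  then have "m - t = (\<Sum>i<n. ?E (\<lambda>z. chi S z * real_of_int (z i)) - t) / real n"
    using \<open>n > 0\<close> by (simp add: sum_subtractf diff_divide_distrib)
  also have "(\<Sum>i<n. ?E (\<lambda>z. chi S z * real_of_int (z i)) - t) =
      (\<Sum>i\<in>R. ?E (\<lambda>z. chi S z * real_of_int (z i)) - t)"
    by (rule sum.mono_neutral_right) (use assms(4) t in auto)
  finally have "\<bar>m - t\<bar> = \<bar>\<Sum>i\<in>R. ?E (\<lambda>z. chi S z * real_of_int (z i)) - t\<bar> / real n"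
    by simp
  also have "\<dots> \<le> (\<Sum>i\<in>R. 2) / real n"
  proof (intro divide_right_mono order.trans[OF sum_abs] sum_mono)
    fix i assume "i \<in> R"
    then have i: "i < n" using assms(4) by auto
    have "\<bar>?E (\<lambda>z. chi S z * real_of_int (z i))\<bar> \<le> ?E (\<lambda>_. 1)"
    proof (rule expectation_abs_le[OF supp])
      fix z assume "z \<in> cube n"
      then show "\<bar>chi S z * real_of_int (z i)\<bar> \<le> 1"
        using cube_values[OF _ i, of z] abs_chi[of z n S] assms(3) by (auto simp: abs_mult)
    qed
    then show "\<bar>?E (\<lambda>z. chi S z * real_of_int (z i)) - t\<bar> \<le> 2"
      using \<open>\<bar>t\<bar> \<le> 1\<close> by simp
  qed auto
  finally have 1: "\<bar>m - t\<bar> \<le> 2 * real (card R) / real n" by (simp add: mult.commute)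
  have "m - b * chi_mean \<zeta> S = ?E (\<lambda>z. chi S z * ((\<Sum>i<n. real_of_int (z i)) / real n - b))"
    unfolding m_def by (simp add: right_diff_distrib int mult.commute)
  also have "\<bar>\<dots>\<bar> \<le> mean_deviation n \<zeta> b"
    unfolding mean_deviation_def
    by (rule expectation_abs_le[OF supp]) (simp add: abs_mult abs_chi[OF _ assms(3)])
  finally show ?thesis using 1 by linarith
qed

text \<open>Multiplying by a coordinate outside \<open>S\<close> enlarges the index set by one
  element, so \<open>chi_mean_step\<close> applies with exceptional set \<open>S\<close>.\<close>

lemma chi_mean_Suc:
  assumes ex: "exchangeable n \<zeta>" and "S \<subseteq> {..<n}" "T \<subseteq> {..<n}" "card T = Suc (card S)"
  shows "\<bar>chi_mean \<zeta> T - b * chi_mean \<zeta> S\<bar> \<le> mean_deviation n \<zeta> b + 2 * real (card S) / real n"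
proof (rule chi_mean_step)
  have fin: "finite S" using assms finite_subset by auto
  show "n > 0" using assms(3,4) by (cases n) auto
  fix i assume "i < n" "i \<notin> S"
  then show "measure_pmf.expectation \<zeta> (\<lambda>z. chi S z * real_of_int (z i)) = chi_mean \<zeta> T"
    using chi_mean_eq[OF ex, of "insert i S" T] assms fin
      ext[of "chi (insert i S)", OF chi_insert[of S i]] by simp
qed (use assms exchangeable_support[OF ex] abs_chi_mean_le_1[OF exchangeable_support[OF ex]] in auto)

text \<open>Multiplying by a coordinate inside \<open>S\<close> removes it, because coordinates
  square to 1. Here the exceptional set is the complement of \<open>S\<close>.\<close>

lemma chi_mean_pred:
  assumes ex: "exchangeable n \<zeta>" and "S \<subseteq> {..<n}" "T \<subseteq> {..<n}" "card S = Suc (card T)"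
  shows "\<bar>chi_mean \<zeta> T - b * chi_mean \<zeta> S\<bar> \<le>
    mean_deviation n \<zeta> b + 2 * real (n - card S) / real n"
proof -
  have fin: "finite S" using assms finite_subset by auto
  have supp: "set_pmf \<zeta> \<subseteq> cube n" by (rule exchangeable_support[OF ex])
  have "\<bar>chi_mean \<zeta> T - b * chi_mean \<zeta> S\<bar> \<le>
      mean_deviation n \<zeta> b + 2 * real (card ({..<n} - S)) / real n"
  proof (rule chi_mean_step[OF supp])
    show "n > 0" using assms(2,4) by (cases n) auto
    fix i assume i: "i < n" "i \<notin> {..<n} - S"
    then have "measure_pmf.expectation \<zeta> (\<lambda>z. chi S z * real_of_int (z i)) = chi_mean \<zeta> (S - {i})"
      unfolding expectation_cube[OF supp]
      by (intro sum.cong refl) (simp add: chi_remove[of _ n i S] fin)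
    also have "\<dots> = chi_mean \<zeta> T"
      using i assms fin by (intro chi_mean_eq[OF ex]) auto
    finally show "measure_pmf.expectation \<zeta> (\<lambda>z. chi S z * real_of_int (z i)) = chi_mean \<zeta> T" .
  qed (use assms abs_chi_mean_le_1[OF supp] in auto)
  then show ?thesis using assms fin by (simp add: card_Diff_subset)
qed

lemma mean_deviation_nonneg: "mean_deviation n \<zeta> b \<ge> 0"
  unfolding mean_deviation_def by (rule Bochner_Integration.integral_nonneg) simp

text \<open>\<open>chi_mean_Suc\<close> is iterated starting from the empty set. As
  \<open>b \<le> 1\<close>, earlier errors are not amplified and the \<open>card S\<close> step
  errors simply add up.\<close>

lemma chi_mean_small_card:
  assumes ex: "exchangeable n \<zeta>" and b: "0 \<le> b" "b \<le> 1" and "S \<subseteq> {..<n}"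
  shows "\<bar>chi_mean \<zeta> S - b ^ card S\<bar> \<le>
    real (card S) * (mean_deviation n \<zeta> b + 2 * real (card S) / real n)"
  using assms(4)
proof (induction "card S" arbitrary: S)
  case 0
  then have "S = {}" using finite_subset by fastforce
  then show ?case by simp
next
  case (Suc k)
  obtain i T where i: "S = insert i T" "i \<notin> T" "card T = k" "finite T"
    using card_Suc_eq_finite[of S k] Suc(2) by metis
  let ?d = "mean_deviation n \<zeta> b"
  have T: "T \<subseteq> {..<n}" using Suc i by auto
  have "\<bar>chi_mean \<zeta> S - b ^ Suc k\<bar> \<le>
      \<bar>chi_mean \<zeta> S - b * chi_mean \<zeta> T\<bar> + \<bar>b * (chi_mean \<zeta> T - b ^ k)\<bar>"
    by (simp add: algebra_simps)
  also have "\<bar>b * (chi_mean \<zeta> T - b ^ k)\<bar> \<le> 1 * \<bar>chi_mean \<zeta> T - b ^ k\<bar>"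
    unfolding abs_mult using b by (intro mult_right_mono) auto
  also have "\<bar>chi_mean \<zeta> S - b * chi_mean \<zeta> T\<bar> \<le> ?d + 2 * real k / real n"
    using chi_mean_Suc[OF ex T Suc(3)] i(3) Suc(2)[symmetric] by simp
  also have "1 * \<bar>chi_mean \<zeta> T - b ^ k\<bar> \<le> real k * (?d + 2 * real k / real n)"
    using Suc(1)[of T] i(3) T by simp
  also have "?d + 2 * real k / real n + real k * (?d + 2 * real k / real n) =
      real (Suc k) * (?d + 2 * real k / real n)"
    by (simp add: distrib_right)
  also have "\<dots> \<le> real (Suc k) * (?d + 2 * real (Suc k) / real n)"
    by (intro mult_left_mono add_left_mono divide_right_mono) auto
  finally show ?case using Suc(2) by simp
qed

text \<open>The mirror image of \<open>chi_mean_small_card\<close>: elements are removed one by one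
  from the full index set, whose mean serves as initial value.\<close>

lemma chi_mean_large_card:
  assumes ex: "exchangeable n \<zeta>" and b: "0 \<le> b" "b \<le> 1" and "S \<subseteq> {..<n}"
  shows "\<bar>chi_mean \<zeta> S - chi_mean \<zeta> {..<n} * b ^ (n - card S)\<bar> \<le>
    real (n - card S) * (mean_deviation n \<zeta> b + 2 * real (n - card S) / real n)"
  using assms(4)
proof (induction "n - card S" arbitrary: S)
  case 0
  then have "S = {..<n}" by (intro card_seteq) auto
  then show ?case by simp
next
  case (Suc k)
  have fin: "finite S" using Suc(3) finite_subset by auto
  have "S \<noteq> {..<n}" using Suc(2) by auto
  then obtain i where i: "i < n" "i \<notin> S" using Suc(3) by auto
  let ?d = "mean_deviation n \<zeta> b" and ?c = "chi_mean \<zeta> {..<n}"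
  define T where "T = insert i S"
  have T: "T \<subseteq> {..<n}" "card T = Suc (card S)" "n - card T = k"
    using Suc i fin by (auto simp: T_def)
  have "\<bar>chi_mean \<zeta> S - ?c * b ^ Suc k\<bar> \<le>
      \<bar>chi_mean \<zeta> S - b * chi_mean \<zeta> T\<bar> + \<bar>b * (chi_mean \<zeta> T - ?c * b ^ k)\<bar>"
    by (simp add: algebra_simps)
  also have "\<bar>b * (chi_mean \<zeta> T - ?c * b ^ k)\<bar> \<le> 1 * \<bar>chi_mean \<zeta> T - ?c * b ^ k\<bar>"
    unfolding abs_mult using b by (intro mult_right_mono) auto
  also have "\<bar>chi_mean \<zeta> S - b * chi_mean \<zeta> T\<bar> \<le> ?d + 2 * real k / real n"
    using chi_mean_pred[OF ex T(1) Suc(3)] T by simp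
  also have "1 * \<bar>chi_mean \<zeta> T - ?c * b ^ k\<bar> \<le> real k * (?d + 2 * real k / real n)"
    using Suc(1)[of T] T by simp
  also have "?d + 2 * real k / real n + real k * (?d + 2 * real k / real n) =
      real (Suc k) * (?d + 2 * real k / real n)"
    by (simp add: distrib_right)
  also have "\<dots> \<le> real (Suc k) * (?d + 2 * real (Suc k) / real n)"
    by (intro mult_left_mono add_left_mono divide_right_mono) auto
  finally show ?case using Suc(2) by simp
qed

section \<open>Characters of intermediate size, by second moments\<close>

lemma expectation_square_le:
  fixes g :: "_ \<Rightarrow> real"
  assumes "set_pmf \<zeta> \<subseteq> cube n"
  shows "(measure_pmf.expectation \<zeta> g)\<^sup>2 \<le> measure_pmf.expectation \<zeta> (\<lambda>z. (g z)\<^sup>2)"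
  using measure_pmf.variance_positive[of \<zeta> g]
    measure_pmf.variance_eq[of \<zeta> g] integrable_cube_support[OF assms] by simp

lemma disjoint_blocks:
  assumes "finite U" "N * d \<le> card U"
  shows "\<exists>A :: nat \<Rightarrow> 'a set. (\<forall>i<N. A i \<subseteq> U \<and> card (A i) = d) \<and>
    (\<forall>i<N. \<forall>j<N. i \<noteq> j \<longrightarrow> A i \<inter> A j = {})"
  using assms
proof (induction N arbitrary: U)
  case (Suc N)
  obtain B where B: "B \<subseteq> U" "card B = d"
    using obtain_subset_with_card_n[of d U] Suc.prems by auto
  have "N * d \<le> card (U - B)"
    using B Suc.prems finite_subset[OF B(1)] by (simp add: card_Diff_subset)
  then obtain A where A: "\<forall>i<N. A i \<subseteq> U - B \<and> card (A i) = d"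
      "\<forall>i<N. \<forall>j<N. i \<noteq> j \<longrightarrow> A i \<inter> A j = {}"
    using Suc.IH[of "U - B"] Suc.prems by blast
  show ?case
  proof (intro exI[of _ "A(N := B)"] conjI allI impI)
    fix i j assume "i < Suc N" "j < Suc N" "i \<noteq> j"
    then consider "i < N" "j < N" | "i = N" "j < N" | "i < N" "j = N" by linarith
    then show "(A(N := B)) i \<inter> (A(N := B)) j = {}"
      using A \<open>i \<noteq> j\<close> by cases auto
  qed (use A B in \<open>auto simp: less_Suc_eq\<close>)
qed auto

text \<open>
  The second moment of an average of \<open>N\<close> characters of equal size whose index sets pairwise
  differ in \<open>2 * d\<close> elements.
\<close>
lemma chi_mean_middle:
  assumes ex: "exchangeable n \<zeta>" and "S \<subseteq> {..<n}" "T \<subseteq> {..<n}" "card T = 2 * d"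
    and "d \<le> card S" "N * d \<le> n - card S" "N > 0"
  shows "(chi_mean \<zeta> S)\<^sup>2 \<le> 1 / real N + \<bar>chi_mean \<zeta> T\<bar>"
proof -
  have supp: "set_pmf \<zeta> \<subseteq> cube n" by (rule exchangeable_support[OF ex])
  have fin: "finite S" using assms finite_subset by auto
  \<comment> \<open>The averaged index sets are \<open>R \<union> A i\<close>, with a common core
    \<open>R\<close> and pairwise disjoint blocks \<open>A i\<close> of size \<open>d\<close>. All
    have the size of \<open>S\<close>, hence the same mean as its character.\<close>
  obtain R where R: "R \<subseteq> S" "card R = card S - d"
    using obtain_subset_with_card_n[of "card S - d" S] by auto
  have finR: "finite R" using R fin finite_subset by blast
  have "N * d \<le> card ({..<n} - R)"
    using R assms finR by (subst card_Diff_subset) auto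
  then obtain A where A': "\<forall>i<N. A i \<subseteq> {..<n} - R \<and> card (A i) = d"
      "\<forall>i<N. \<forall>j<N. i \<noteq> j \<longrightarrow> A i \<inter> A j = {}"
    using disjoint_blocks[of "{..<n} - R" N d] by blast
  then have A: "\<And>i. i < N \<Longrightarrow> A i \<subseteq> {..<n} - R" "\<And>i. i < N \<Longrightarrow> card (A i) = d"
      "\<And>i j. i < N \<Longrightarrow> j < N \<Longrightarrow> i \<noteq> j \<Longrightarrow> A i \<inter> A j = {}"
    by blast+
  have finA: "finite (A i)" if "i < N" for i
    using A(1)[OF that] finite_subset by blast
  let ?E = "measure_pmf.expectation \<zeta>"
  define X where "X z = (\<Sum>i<N. chi (R \<union> A i) z) / real N" for z
  note int = integrable_cube_support[OF supp]
  have "?E X = (\<Sum>i<N. chi_mean \<zeta> (R \<union> A i)) / real N"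
    unfolding X_def by (simp add: int)
  also have "(\<Sum>i<N. chi_mean \<zeta> (R \<union> A i)) = (\<Sum>i<N. chi_mean \<zeta> S)"
  proof (intro sum.cong refl chi_mean_eq[OF ex] assms(2))
    fix i assume "i \<in> {..<N}"
    then have i: "i < N" by simp
    show "R \<union> A i \<subseteq> {..<n}" using A(1)[OF i] R(1) assms(2) by auto
    have "card (R \<union> A i) = card R + card (A i)"
      using A(1)[OF i] finA[OF i] finR by (intro card_Un_disjoint) auto
    then show "card (R \<union> A i) = card S" using A(2)[OF i] R assms by simp
  qed
  finally have EX: "?E X = chi_mean \<zeta> S" using \<open>N > 0\<close> by simp
  have off_diag: "?E (\<lambda>z. chi (R \<union> A i) z * chi (R \<union> A j) z) = (if i = j then 1 else chi_mean \<zeta> T)"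
    if ij: "i < N" "j < N" for i j
  proof (cases "i = j")
    case True
    have "R \<union> A i \<subseteq> {..<n}" using A(1)[OF ij(1)] R(1) assms(2) by auto
    then have "?E (\<lambda>z. chi (R \<union> A i) z * chi (R \<union> A i) z) = ?E (\<lambda>_. 1)"
      unfolding expectation_cube[OF supp] by (intro sum.cong refl) (simp add: chi_square)
    then show ?thesis using True by simp
  next
    case False
    \<comment> \<open>The core cancels in the product, leaving two disjoint blocks, that is, an
      index set of size \<open>2 * d\<close> like \<open>T\<close>.\<close>
    have "?E (\<lambda>z. chi (R \<union> A i) z * chi (R \<union> A j) z) = chi_mean \<zeta> (A i \<union> A j)"
      unfolding expectation_cube[OF supp]
    proof (intro sum.cong refl arg_cong2[where f = "(*)"])
      fix z assume z: "z \<in> cube n"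
      have "chi (R \<union> A i) z = chi R z * chi (A i) z" if "i < N" for i
        using A(1)[OF that] finA[OF that] finR by (intro chi_union_disjoint) auto
      then have "chi (R \<union> A i) z * chi (R \<union> A j) z =
          (chi R z * chi R z) * (chi (A i) z * chi (A j) z)"
        using ij by simp
      also have "chi R z * chi R z = 1"
        using chi_square[OF z, of R] R assms(2) by auto
      also have "chi (A i) z * chi (A j) z = chi (A i \<union> A j) z"
        using A(3)[OF ij False] finA ij by (intro chi_union_disjoint[symmetric]) auto
      finally show "chi (R \<union> A i) z * chi (R \<union> A j) z = chi (A i \<union> A j) z" by simp
    qed
    also have "\<dots> = chi_mean \<zeta> T"
    proof (rule chi_mean_eq[OF ex _ assms(3)])
      show "A i \<union> A j \<subseteq> {..<n}" using A(1) ij by auto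
      have "card (A i \<union> A j) = card (A i) + card (A j)"
        using A(3)[OF ij False] finA ij by (intro card_Un_disjoint) auto
      then show "card (A i \<union> A j) = card T" using A(2) ij assms(4) by simp
    qed
    finally show ?thesis using False by simp
  qed
  \<comment> \<open>The absolute value is added on the diagonal too: this only weakens the bound and
    makes the double sum easy to evaluate.\<close>
  have "(\<Sum>i<N. \<Sum>j<N. ?E (\<lambda>z. chi (R \<union> A i) z * chi (R \<union> A j) z)) \<le>
      (\<Sum>i<N. \<Sum>j<N. (if i = j then 1 else 0) + \<bar>chi_mean \<zeta> T\<bar>)"
    using off_diag by (intro sum_mono) auto
  also have "\<dots> = real N + (real N)\<^sup>2 * \<bar>chi_mean \<zeta> T\<bar>"
    by (simp add: sum.distrib power2_eq_square distrib_left)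
  finally have second_moment: "(\<Sum>i<N. \<Sum>j<N. ?E (\<lambda>z. chi (R \<union> A i) z * chi (R \<union> A j) z)) \<le>
      real N + (real N)\<^sup>2 * \<bar>chi_mean \<zeta> T\<bar>" .
  have "(chi_mean \<zeta> S)\<^sup>2 \<le> ?E (\<lambda>z. (X z)\<^sup>2)"
    unfolding EX[symmetric] by (rule expectation_square_le[OF supp])
  also have "?E (\<lambda>z. (X z)\<^sup>2) =
      (\<Sum>i<N. \<Sum>j<N. ?E (\<lambda>z. chi (R \<union> A i) z * chi (R \<union> A j) z)) / (real N)\<^sup>2"
    unfolding X_def power_divide by (simp add: power2_eq_square sum_product int)
  also have "\<dots> \<le> (real N + (real N)\<^sup>2 * \<bar>chi_mean \<zeta> T\<bar>) / (real N)\<^sup>2"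
    using second_moment by (rule divide_right_mono) simp
  also have "\<dots> = 1 / real N + \<bar>chi_mean \<zeta> T\<bar>"
    using \<open>N > 0\<close> by (simp add: add_divide_distrib power2_eq_square)
  finally show ?thesis .
qed

section \<open>Approximation uniform in the index set and in the function\<close>

text \<open>Sets of size at most a constant \<open>K\<close>, or missing at most \<open>K\<close>
  indices, are handled by the two inductions, where the other power of \<open>b\<close> is
  negligible. For all remaining sets both powers are negligible and the second moment bound makes
  the mean itself small.\<close>

lemma chi_mean_uniform:
  fixes \<zeta> :: "nat \<Rightarrow> (nat \<Rightarrow> int) pmf"
  assumes ex: "\<forall>\<^sub>F n in sequentially. exchangeable n (\<zeta> n)"
    and dev: "(\<lambda>n. mean_deviation n (\<zeta> n) b) \<longlonglongrightarrow> 0"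
    and b: "0 \<le> b" "b < 1" and "\<epsilon> > 0"
  shows "\<forall>\<^sub>F n in sequentially. \<forall>S\<subseteq>{..<n}.
    \<bar>chi_mean (\<zeta> n) S - b ^ card S - chi_mean (\<zeta> n) {..<n} * b ^ (n - card S)\<bar> \<le> \<epsilon>"
proof -
  \<comment> \<open>The middle case needs three terms of size \<open>\<epsilon> / 3\<close>. There
    the squared mean is at most \<open>1 / N + 2 * \<gamma>\<close>, hence at most
    \<open>3 * \<gamma>\<close>, which must not exceed \<open>\<epsilon>\<^sup>2 / 9\<close>; this
    explains the 27.\<close>
  define \<gamma> where "\<gamma> = min (\<epsilon> / 3) (\<epsilon>\<^sup>2 / 27)"
  have "\<gamma> > 0" using \<open>\<epsilon> > 0\<close> by (simp add: \<gamma>_def)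
  have \<gamma>: "\<gamma> \<le> \<epsilon> / 3" "3 * \<gamma> \<le> (\<epsilon> / 3)\<^sup>2"
    by (auto simp: \<gamma>_def power_divide)
  obtain d where d: "b ^ d < \<gamma>" using real_arch_pow_inv[OF \<open>\<gamma> > 0\<close> b(2)] by blast
  have pow: "b ^ k \<le> \<gamma>" if "d \<le> k" for k
    using power_decreasing[OF that, of b] b d by linarith
  obtain N0 :: nat where "1 / \<gamma> < real N0" using reals_Archimedean2 by blast
  define N where "N = N0 + 2"
  have "1 / \<gamma> < real N" using \<open>1 / \<gamma> < real N0\<close> by (simp add: N_def)
  then have N: "1 / real N \<le> \<gamma>" "N \<ge> 2"
    using \<open>\<gamma> > 0\<close> by (auto simp: field_simps N_def)
  \<comment> \<open>In the middle case \<open>N\<close> blocks of size \<open>d\<close> must fit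
    outside \<open>S\<close>. Since \<open>N \<ge> 2\<close>, sets of size \<open>2 * d\<close>
    count as small, so the mean of the comparison character is controlled as well.\<close>
  define K where "K = N * d"
  have K: "2 * d \<le> K" using N(2) by (simp add: K_def)
  have "(\<lambda>n. real K * (mean_deviation n (\<zeta> n) b + 2 * real K * (1 / real n))) \<longlonglongrightarrow>
      real K * (0 + 2 * real K * 0)"
    by (intro tendsto_intros dev lim_1_over_n)
  then have "(\<lambda>n. real K * (mean_deviation n (\<zeta> n) b + 2 * real K / real n)) \<longlonglongrightarrow> 0"
    by simp
  then have "\<forall>\<^sub>F n in sequentially. real K * (mean_deviation n (\<zeta> n) b + 2 * real K / real n) < \<gamma>"
    by (rule order_tendstoD(2)) (rule \<open>\<gamma> > 0\<close>)
  then show ?thesis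
    using ex eventually_ge_at_top[of "2 * K"]
  proof eventually_elim
    case (elim n)
    note ex = elim(2)
    have supp: "set_pmf (\<zeta> n) \<subseteq> cube n" by (rule exchangeable_support[OF ex])
    let ?c = "chi_mean (\<zeta> n) {..<n}"
    have c: "\<bar>?c\<bar> \<le> 1" by (rule abs_chi_mean_le_1[OF supp]) simp
    have small: "real k * (mean_deviation n (\<zeta> n) b + 2 * real k / real n) \<le> \<gamma>" if "k \<le> K" for k
    proof -
      have "real k * (mean_deviation n (\<zeta> n) b + 2 * real k / real n) \<le>
          real K * (mean_deviation n (\<zeta> n) b + 2 * real K / real n)"
        using that by (intro mult_mono add_mono divide_right_mono)
          (auto simp: mean_deviation_nonneg)
      then show ?thesis using elim(1) by linarith
    qed
    have c_pow: "\<bar>?c * b ^ k\<bar> \<le> \<gamma>" if "d \<le> k" for k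
    proof -
      have "\<bar>?c * b ^ k\<bar> \<le> 1 * b ^ k"
        unfolding abs_mult using c b by (intro mult_mono) auto
      then show ?thesis using pow[OF that] by linarith
    qed
    show ?case
    proof (intro allI impI)
      fix S assume S: "S \<subseteq> {..<n}"
      have "card S \<le> n" using card_mono[OF _ S] by simp
      consider "card S \<le> K" | "n - card S \<le> K" | "K \<le> card S" "K \<le> n - card S" by linarith
      then show "\<bar>chi_mean (\<zeta> n) S - b ^ card S - ?c * b ^ (n - card S)\<bar> \<le> \<epsilon>"
      proof cases
        case 1
        have "\<bar>chi_mean (\<zeta> n) S - b ^ card S\<bar> \<le> \<gamma>"
          using chi_mean_small_card[OF ex b(1) _ S] b(2) small[OF 1] by simp
        moreover have "\<bar>?c * b ^ (n - card S)\<bar> \<le> \<gamma>"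
          by (rule c_pow) (use 1 elim(3) K in linarith)
        ultimately show ?thesis using \<gamma>(1) \<open>\<gamma> > 0\<close> by linarith
      next
        case 2
        have "\<bar>chi_mean (\<zeta> n) S - ?c * b ^ (n - card S)\<bar> \<le> \<gamma>"
          using chi_mean_large_card[OF ex b(1) _ S] b(2) small[OF 2] by simp
        moreover have "b ^ card S \<le> \<gamma>"
          by (rule pow) (use 2 elim(3) K \<open>card S \<le> n\<close> in linarith)
        moreover have "b ^ card S \<ge> 0" using b by simp
        ultimately show ?thesis using \<gamma>(1) \<open>\<gamma> > 0\<close> by linarith
      next
        case 3
        let ?T = "{..<2 * d}"
        have T: "?T \<subseteq> {..<n}" using K elim(3) by auto
        have "\<bar>chi_mean (\<zeta> n) ?T - b ^ (2 * d)\<bar> \<le> \<gamma>"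
          using chi_mean_small_card[OF ex b(1) _ T] b(2) small[OF K] by simp
        moreover have "b ^ (2 * d) \<le> \<gamma>" "b ^ (2 * d) \<ge> 0" using pow[of "2 * d"] b by auto
        ultimately have "\<bar>chi_mean (\<zeta> n) ?T\<bar> \<le> 2 * \<gamma>" by linarith
        moreover have "(chi_mean (\<zeta> n) S)\<^sup>2 \<le> 1 / real N + \<bar>chi_mean (\<zeta> n) ?T\<bar>"
          using 3 K N by (intro chi_mean_middle[OF ex S T, where d = d and N = N]) (simp_all add: K_def[symmetric])
        ultimately have "(chi_mean (\<zeta> n) S)\<^sup>2 \<le> (\<epsilon> / 3)\<^sup>2"
          using \<gamma>(2) N(1) by linarith
        then have "\<bar>chi_mean (\<zeta> n) S\<bar> \<le> \<epsilon> / 3"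
          using \<open>\<epsilon> > 0\<close> abs_le_square_iff[of "chi_mean (\<zeta> n) S" "\<epsilon> / 3"] by simp
        moreover have "b ^ card S \<le> \<gamma>" by (rule pow) (use 3 K in linarith)
        moreover have "\<bar>?c * b ^ (n - card S)\<bar> \<le> \<gamma>" by (rule c_pow) (use 3 K in linarith)
        moreover have "b ^ card S \<ge> 0" using b by simp
        ultimately show ?thesis using \<gamma>(1) by linarith
      qed
    qed
  qed
qed

lemma fourier_weight_le_1:
  assumes "\<And>x. x \<in> cube n \<Longrightarrow> \<bar>f x\<bar> \<le> 1"
  shows "(\<Sum>S\<in>Pow {..<n}. (fourier n f S)\<^sup>2) \<le> 1"
proof -
  have "(\<Sum>x\<in>cube n. (f x)\<^sup>2) \<le> (\<Sum>x\<in>cube n. 1)"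
    using assms by (intro sum_mono) (simp add: abs_square_le_1)
  then show ?thesis unfolding parseval by simp
qed

text \<open>The error is the sum of the errors for the single characters, weighted by the squared
  Fourier coefficients. These have total mass at most 1 by Parseval, so the bound does not depend on
  \<open>f\<close>.\<close>

lemma noise_stab_uniform:
  fixes \<zeta> :: "nat \<Rightarrow> (nat \<Rightarrow> int) pmf"
  assumes ex: "\<forall>\<^sub>F n in sequentially. exchangeable n (\<zeta> n)"
    and dev: "(\<lambda>n. mean_deviation n (\<zeta> n) (1 - 2 * \<beta>)) \<longlonglongrightarrow> 0"
    and \<beta>: "0 < \<beta>" "\<beta> \<le> 1 / 2" and "\<epsilon> > 0"
  shows "\<forall>\<^sub>F n in sequentially. \<forall>f. (\<forall>x\<in>cube n. \<bar>f x\<bar> \<le> 1) \<longrightarrow>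
    \<bar>noise_stab n (\<zeta> n) f - Stab n \<beta> f -
      chi_mean (\<zeta> n) {..<n} * Stab n \<beta> (\<lambda>x. f x * chi {..<n} x)\<bar> \<le> \<epsilon>"
proof -
  have "\<forall>\<^sub>F n in sequentially. \<forall>S\<subseteq>{..<n}.
    \<bar>chi_mean (\<zeta> n) S - (1 - 2 * \<beta>) ^ card S -
      chi_mean (\<zeta> n) {..<n} * (1 - 2 * \<beta>) ^ (n - card S)\<bar> \<le> \<epsilon>"
    by (rule chi_mean_uniform[OF ex dev]) (use assms in auto)
  then show ?thesis
    using ex
  proof eventually_elim
    case (elim n)
    show ?case
    proof (intro allI impI)
      fix f :: "(nat \<Rightarrow> int) \<Rightarrow> real" assume f: "\<forall>x\<in>cube n. \<bar>f x\<bar> \<le> 1"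
      let ?c = "chi_mean (\<zeta> n) {..<n}" and ?b = "1 - 2 * \<beta>"
      have \<beta>': "0 \<le> \<beta>" "\<beta> \<le> 1" using \<beta> by auto
      have "noise_stab n (\<zeta> n) f - Stab n \<beta> f - ?c * Stab n \<beta> (\<lambda>x. f x * chi {..<n} x) =
        (\<Sum>S\<in>Pow {..<n}. (fourier n f S)\<^sup>2 *
            (chi_mean (\<zeta> n) S - ?b ^ card S - ?c * ?b ^ (n - card S)))"
        unfolding Stab_mult_chi_full_fourier[OF \<beta>'] unfolding Stab_fourier[OF \<beta>']
          noise_stab_fourier[OF exchangeable_support[OF elim(2)]] sum_distrib_left
          sum_subtractf[symmetric]
        by (intro sum.cong refl) (simp only: right_diff_distrib mult.left_commute)
      also have "\<bar>\<dots>\<bar> \<le> (\<Sum>S\<in>Pow {..<n}. (fourier n f S)\<^sup>2 * \<epsilon>)"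
        using elim(1)
        by (intro order.trans[OF sum_abs] sum_mono) (auto simp: abs_mult intro!: mult_left_mono)
      also have "\<dots> = (\<Sum>S\<in>Pow {..<n}. (fourier n f S)\<^sup>2) * \<epsilon>"
        by (simp add: sum_distrib_right)
      also have "\<dots> \<le> 1 * \<epsilon>"
        using f \<open>\<epsilon> > 0\<close> by (intro mult_right_mono fourier_weight_le_1) auto
      finally show "\<bar>noise_stab n (\<zeta> n) f - Stab n \<beta> f -
          ?c * Stab n \<beta> (\<lambda>x. f x * chi {..<n} x)\<bar> \<le> \<epsilon>" by simp
    qed
  qed
qed

section \<open>Cylinders\<close>

definition cylinder :: "nat \<Rightarrow> nat \<Rightarrow> (nat \<Rightarrow> int) set \<Rightarrow> (nat \<Rightarrow> int) set" where
  "cylinder m n A = {x \<in> cube n. restrict x {..<m} \<in> A}"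

lemma sum_cube_Suc:
  "(\<Sum>x\<in>cube (Suc n). h x) = (\<Sum>x\<in>cube n. h (x(n := -1)) + h (x(n := 1)))"
  for h :: "_ \<Rightarrow> real"
proof -
  have "cube (Suc n) = (\<lambda>(y, g). g(n := y)) ` ({-1, 1} \<times> cube n)"
    unfolding cube_def lessThan_Suc PiE_insert_eq by simp
  moreover have "inj_on (\<lambda>(y, g). g(n := y)) ({-1, 1} \<times> cube n)"
    unfolding cube_def using inj_combinator[of n "{..<n}" "\<lambda>_. {-1, 1}"] by simp
  ultimately have "(\<Sum>x\<in>cube (Suc n). h x) = (\<Sum>y\<in>{-1, 1}. \<Sum>g\<in>cube n. h (g(n := y)))"
    by (simp add: sum.reindex case_prod_unfold sum.cartesian_product')
  then show ?thesis by (simp add: sum.distrib)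
qed

lemma sum_cube_restrict:
  fixes h :: "_ \<Rightarrow> real"
  assumes "m \<le> n"
  shows "(\<Sum>x\<in>cube n. h (restrict x {..<m})) = 2 ^ (n - m) * (\<Sum>y\<in>cube m. h y)"
  using assms
proof (induction n rule: dec_induct)
  case base
  have "restrict x {..<m} = x" if "x \<in> cube m" for x
    using that unfolding cube_def by (rule PiE_restrict)
  then show ?case by simp
next
  case (step n)
  have r: "restrict (x(n := y)) {..<m} = restrict x {..<m}" for x and y :: int
    using step(1) by (auto simp: restrict_def fun_eq_iff)
  show ?case
    unfolding sum_cube_Suc r sum.distrib step.IH using step(1) by (simp add: Suc_diff_le)
qed

lemma cylinder_subset: "cylinder m n A \<subseteq> cube n"
  by (auto simp: cylinder_def)

lemma fourier_cylinder:
  assumes "m \<le> n" "S \<subseteq> {..<m}"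
  shows "fourier n (indicator (cylinder m n A)) S = fourier m (indicator A) S"
proof -
  have "(\<Sum>x\<in>cube n. indicator (cylinder m n A) x * chi S x) =
      (\<Sum>x\<in>cube n. indicator A (restrict x {..<m}) * chi S (restrict x {..<m}))"
  proof (intro sum.cong refl arg_cong2[where f = "(*)"])
    show "chi S x = chi S (restrict x {..<m})" for x
      unfolding chi_def using assms(2) by (intro prod.cong) auto
  qed (auto simp: cylinder_def indicator_def)
  also have "\<dots> = 2 ^ (n - m) * (\<Sum>y\<in>cube m. indicator A y * chi S y)"
    by (rule sum_cube_restrict[OF assms(1)])
  finally show ?thesis
    unfolding fourier_def using assms(1) by (simp add: power_diff field_simps)
qed

text \<open>Flipping a coordinate of \<open>S\<close> with index at least \<open>m\<close> preserves
  the cylinder and negates the character, so the sum equals its own negative.\<close>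

lemma fourier_cylinder_eq_0:
  assumes "S \<subseteq> {..<n}" "\<not> S \<subseteq> {..<m}"
  shows "fourier n (indicator (cylinder m n A)) S = 0"
proof -
  obtain i where i: "i \<in> S" "\<not> i < m" using assms(2) by auto
  then have "i < n" using assms(1) by auto
  have fin: "finite S" using assms(1) finite_subset by blast
  define flip where "flip x = x(i := - x i)" for x :: "nat \<Rightarrow> int"
  have flip_cube: "flip x \<in> cube n" if "x \<in> cube n" for x
    using that \<open>i < n\<close> cube_values[OF that \<open>i < n\<close>]
    by (auto simp: cube_def PiE_def Pi_def extensional_def flip_def)
  have flip_restrict: "restrict (flip x) {..<m} = restrict x {..<m}" for x
    using i(2) by (auto simp: restrict_def fun_eq_iff flip_def)
  have chi_flip: "chi S (flip x) = - chi S x" for x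
  proof -
    have "chi S y = chi (S - {i}) y * real_of_int (y i)" for y
      using chi_insert[of "S - {i}" i y] i(1) fin by (simp add: insert_absorb)
    moreover have "chi (S - {i}) (flip x) = chi (S - {i}) x"
      unfolding chi_def flip_def by (intro prod.cong) auto
    ultimately show ?thesis by (simp add: flip_def)
  qed
  let ?f = "\<lambda>x. indicator (cylinder m n A) x * chi S x :: real"
  have "bij_betw flip (cube n) (cube n)"
    by (rule bij_betwI[where g = flip]) (use flip_cube in \<open>auto simp: flip_def\<close>)
  then have "(\<Sum>x\<in>cube n. ?f x) = (\<Sum>x\<in>cube n. ?f (flip x))"
    by (rule sum.reindex_bij_betw[symmetric])
  also have "\<dots> = (\<Sum>x\<in>cube n. - ?f x)"
    by (intro sum.cong refl)
       (auto simp: chi_flip cylinder_def flip_restrict flip_cube indicator_def)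
  finally have "(\<Sum>x\<in>cube n. ?f x) = 0" by (simp add: sum_negf)
  then show ?thesis by (simp add: fourier_def)
qed

text \<open>The weight is kept arbitrary because two are used: the power with exponent
  \<open>card S\<close> for the cylinder itself, and the one with exponent \<open>n - card S\<close>
  after multiplication by the parity character.\<close>

lemma sum_fourier_cylinder:
  assumes "m \<le> n"
  shows "(\<Sum>S\<in>Pow {..<n}. (fourier n (indicator (cylinder m n A)) S)\<^sup>2 * w S) =
    (\<Sum>S\<in>Pow {..<m}. (fourier m (indicator A) S)\<^sup>2 * w S)"
proof -
  have "(\<Sum>S\<in>Pow {..<n}. (fourier n (indicator (cylinder m n A)) S)\<^sup>2 * w S) =
    (\<Sum>S\<in>Pow {..<m}. (fourier n (indicator (cylinder m n A)) S)\<^sup>2 * w S)"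
    by (rule sum.mono_neutral_right) (use assms fourier_cylinder_eq_0 in auto)
  then show ?thesis using fourier_cylinder[OF assms] by simp
qed

lemma Stab_cylinder:
  assumes "m \<le> n" "0 \<le> \<beta>" "\<beta> \<le> 1"
  shows "Stab n \<beta> (indicator (cylinder m n A)) = Stab m \<beta> (indicator A)"
  unfolding Stab_fourier[OF assms(2,3)] by (rule sum_fourier_cylinder[OF assms(1)])

text \<open>The spectrum of a cylinder lives on sets of size at most \<open>m\<close>. The parity
  character moves it to sets of size at least \<open>n - m\<close>, where the noise damps it; the
  total weight is at most 1.\<close>

lemma Stab_cylinder_mult_chi_full:
  assumes "m \<le> n" "0 \<le> \<beta>" "\<beta> \<le> 1 / 2"
  shows "Stab n \<beta> (\<lambda>x. indicator (cylinder m n A) x * chi {..<n} x) \<le> (1 - 2 * \<beta>) ^ (n - m)"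
proof -
  have "Stab n \<beta> (\<lambda>x. indicator (cylinder m n A) x * chi {..<n} x) =
      (\<Sum>S\<in>Pow {..<m}. (fourier m (indicator A) S)\<^sup>2 * (1 - 2 * \<beta>) ^ (n - card S))"
    using assms by (simp add: Stab_mult_chi_full_fourier sum_fourier_cylinder)
  also have "\<dots> \<le> (\<Sum>S\<in>Pow {..<m}. (fourier m (indicator A) S)\<^sup>2 * (1 - 2 * \<beta>) ^ (n - m))"
  proof (intro sum_mono mult_left_mono power_decreasing)
    fix S assume "S \<in> Pow {..<m}"
    then have "card S \<le> m" using card_mono[of "{..<m}" S] by simp
    then show "n - m \<le> n - card S" by simp
  qed (use assms in auto)
  also have "\<dots> = (\<Sum>S\<in>Pow {..<m}. (fourier m (indicator A) S)\<^sup>2) * (1 - 2 * \<beta>) ^ (n - m)"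
    by (simp add: sum_distrib_right)
  also have "\<dots> \<le> 1 * (1 - 2 * \<beta>) ^ (n - m)"
    using assms by (intro mult_right_mono fourier_weight_le_1) (auto simp: indicator_def)
  finally show ?thesis by simp
qed

text \<open>Lets cardinalities of cylinders and of their even parts be read off from the coefficient
  at the empty set.\<close>

lemma card_eq_fourier_empty:
  assumes "A \<subseteq> cube n"
  shows "real (card A) = 2 ^ n * fourier n (indicator A) {}"
proof -
  have "(\<Sum>x\<in>cube n. indicator A x) = real (card (cube n \<inter> A))"
    by (simp add: indicator_def sum.If_cases of_bool_def Int_def)
  then show ?thesis using assms by (simp add: fourier_def Int_absorb1)
qed

lemma card_cylinder:
  assumes "m \<le> n" "A \<subseteq> cube m"
  shows "card (cylinder m n A) = card A * 2 ^ (n - m)"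
proof -
  have "real (card (cylinder m n A)) = 2 ^ n * fourier m (indicator A) {}"
    using fourier_cylinder[OF assms(1), of "{}" A]
    by (simp add: card_eq_fourier_empty[OF cylinder_subset])
  also have "\<dots> = real (card A) * 2 ^ (n - m)"
    using assms(1) by (simp add: card_eq_fourier_empty[OF assms(2)] power_diff)
  also have "\<dots> = real (card A * 2 ^ (n - m))" by simp
  finally show ?thesis by (simp only: of_nat_eq_iff)
qed

section \<open>Restriction to points of even parity\<close>

definition even_part :: "nat \<Rightarrow> (nat \<Rightarrow> int) set \<Rightarrow> (nat \<Rightarrow> int) set" where
  "even_part n A = {x \<in> A. chi {..<n} x = 1}"

text \<open>On the cube, the indicator of even parity is half of 1 plus the parity character, which
  contributes the coefficient at the complement.\<close>

lemma fourier_even_part: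
  assumes "S \<subseteq> {..<n}"
  shows "fourier n (indicator (even_part n A)) S =
    (fourier n (indicator A) S + fourier n (indicator A) ({..<n} - S)) / 2"
proof -
  have "(\<Sum>x\<in>cube n. indicator (even_part n A) x * chi S x) =
      (\<Sum>x\<in>cube n. (indicator A x * chi S x + indicator A x * chi ({..<n} - S) x) / 2)"
  proof (intro sum.cong refl)
    fix x assume x: "x \<in> cube n"
    show "indicator (even_part n A) x * chi S x =
        (indicator A x * chi S x + indicator A x * chi ({..<n} - S) x) / 2"
      using chi_complement[OF x assms] chi_cases[OF x, of "{..<n}"]
      by (auto simp: even_part_def indicator_def)
  qed
  then show ?thesis
    by (simp add: fourier_def sum.distrib sum_divide_distrib[symmetric] add_divide_distrib)
qed

text \<open>With \<open>m < n\<close> some coordinate is free, so the coefficient of the cylinder at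
  the full set vanishes: even and odd points balance.\<close>

lemma card_even_part_cylinder:
  assumes "m < n" "A \<subseteq> cube m"
  shows "2 * card (even_part n (cylinder m n A)) = card (cylinder m n A)"
proof -
  have sub: "even_part n (cylinder m n A) \<subseteq> cube n"
    using cylinder_subset by (auto simp: even_part_def)
  have "fourier n (indicator (cylinder m n A)) {..<n} = 0"
    using assms(1) by (intro fourier_cylinder_eq_0) auto
  then have "real (2 * card (even_part n (cylinder m n A))) = real (card (cylinder m n A))"
    using fourier_even_part[of "{}" n "cylinder m n A"]
    by (simp add: card_eq_fourier_empty[OF sub] card_eq_fourier_empty[OF cylinder_subset])
  then show ?thesis by (simp only: of_nat_eq_iff)
qed

text \<open>On subsets of \<open>{..<m}\<close> the coefficients of the even part are half of those
  of \<open>A\<close>, which yields the factor 1/4 after squaring. The terms for all other sets are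
  nonnegative and are dropped.\<close>

lemma Stab_even_part_cylinder:
  assumes "m < n" "0 \<le> \<beta>" "\<beta> \<le> 1 / 2"
  shows "Stab n \<beta> (indicator (even_part n (cylinder m n A))) \<ge> Stab m \<beta> (indicator A) / 4"
proof -
  let ?C = "cylinder m n A" and ?b = "1 - 2 * \<beta>"
  have \<beta>: "0 \<le> \<beta>" "\<beta> \<le> 1" using assms by auto
  have "Stab m \<beta> (indicator A) / 4 =
      (\<Sum>S\<in>Pow {..<m}. (fourier m (indicator A) S / 2)\<^sup>2 * ?b ^ card S)"
    by (simp add: Stab_fourier[OF \<beta>] sum_divide_distrib power_divide)
  also have "\<dots> = (\<Sum>S\<in>Pow {..<m}. (fourier n (indicator (even_part n ?C)) S)\<^sup>2 * ?b ^ card S)"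
  proof (intro sum.cong refl)
    fix S assume "S \<in> Pow {..<m}"
    then have S: "S \<subseteq> {..<m}" "S \<subseteq> {..<n}" using assms(1) by auto
    have "m \<in> {..<n} - S" using S assms(1) by auto
    then have "fourier n (indicator ?C) ({..<n} - S) = 0"
      by (intro fourier_cylinder_eq_0) auto
    then show "(fourier m (indicator A) S / 2)\<^sup>2 * ?b ^ card S =
        (fourier n (indicator (even_part n ?C)) S)\<^sup>2 * ?b ^ card S"
      unfolding fourier_even_part[OF S(2), of ?C]
      using fourier_cylinder[of m n S A] S(1) assms(1) by simp
  qed
  also have "\<dots> \<le> (\<Sum>S\<in>Pow {..<n}. (fourier n (indicator (even_part n ?C)) S)\<^sup>2 * ?b ^ card S)"
    by (rule sum_mono2) (use assms in auto)
  also have "\<dots> = Stab n \<beta> (indicator (even_part n ?C))" by (simp add: Stab_fourier[OF \<beta>])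
  finally show ?thesis .
qed

section \<open>Maximal stability\<close>

text \<open>Reduces the maximisation to sets of \<open>M\<close> points. The restriction appears
  because the competing functions are extensional on the cube.\<close>

lemma bool_funs_eq:
  "bool_funs n M = (\<lambda>A. restrict (indicator A) (cube n)) ` {A. A \<subseteq> cube n \<and> card A = M}"
proof (intro equalityI subsetI)
  fix f assume "f \<in> bool_funs n M"
  then have f: "f \<in> cube n \<rightarrow>\<^sub>E {0, 1}"
    and M: "measure_pmf.prob (pmf_of_set (cube n)) {x. f x = 1} = real M / 2 ^ n"
    by (auto simp: bool_funs_def)
  let ?A = "{x \<in> cube n. f x = 1}"
  have "cube n \<inter> {x. f x = 1} = ?A" by auto
  then have "card ?A = M" using M by (simp add: measure_pmf_of_set)
  moreover have "f = restrict (indicator ?A) (cube n)"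
    by (rule PiE_ext[OF f]) (use f in \<open>auto simp: indicator_def\<close>)
  ultimately show "f \<in> (\<lambda>A. restrict (indicator A) (cube n)) ` {A. A \<subseteq> cube n \<and> card A = M}"
    by blast
next
  fix f assume "f \<in> (\<lambda>A. restrict (indicator A) (cube n) :: _ \<Rightarrow> real) `
    {A. A \<subseteq> cube n \<and> card A = M}"
  then obtain A where A: "A \<subseteq> cube n" "card A = M" "f = restrict (indicator A) (cube n)" by auto
  have "cube n \<inter> {x. f x = 1} = A" using A by (auto simp: indicator_def)
  then show "f \<in> bool_funs n M"
    using A by (auto simp: bool_funs_def measure_pmf_of_set indicator_def)
qed

definition max_stab :: "nat \<Rightarrow> (nat \<Rightarrow> int) pmf \<Rightarrow> nat \<Rightarrow> real" where
  "max_stab n \<zeta> M = Max (noise_stab n \<zeta> ` bool_funs n M)"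

lemma GammaN_S_eq: "GammaN_S n M r = max_stab n (pmf_of_set (hsphere n r)) M"
  by (simp add: GammaN_S_def max_stab_def SStab_def[abs_def])

lemma GammaN_B_eq: "GammaN_B n M r = max_stab n (pmf_of_set (hball n r)) M"
  by (simp add: GammaN_B_def max_stab_def BStab_def[abs_def])

lemma GammaN_IID_eq: "GammaN_IID n M \<beta> = max_stab n (iid_noise n \<beta>) M"
  by (simp add: GammaN_IID_def max_stab_def Stab_def[abs_def])

lemma finite_bool_funs: "finite (bool_funs n M)"
  unfolding bool_funs_eq by simp

lemma exists_superset_card:
  assumes "A \<subseteq> B" "finite B" "card A \<le> M" "M \<le> card B"
  shows "\<exists>C. A \<subseteq> C \<and> C \<subseteq> B \<and> card C = M"
proof -
  have finA: "finite A" using assms finite_subset by blast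
  have "M - card A \<le> card (B - A)" using assms finA by (simp add: card_Diff_subset)
  then obtain D where D: "D \<subseteq> B - A" "card D = M - card A"
    using obtain_subset_with_card_n by metis
  have "finite D" using D assms(2) finite_subset by blast
  then have "card (A \<union> D) = card A + card D" using D finA by (intro card_Un_disjoint) auto
  then show ?thesis using D assms by (intro exI[of _ "A \<union> D"]) auto
qed

lemma noise_stab_restrict:
  assumes "set_pmf \<zeta> \<subseteq> cube n"
  shows "noise_stab n \<zeta> (restrict f (cube n)) = noise_stab n \<zeta> f"
  by (rule noise_stab_cong[OF assms]) simp

lemma max_stab_attained:
  assumes "set_pmf \<zeta> \<subseteq> cube n" "M \<le> 2 ^ n"
  shows "\<exists>A\<subseteq>cube n. card A = M \<and> max_stab n \<zeta> M = noise_stab n \<zeta> (indicator A)"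
proof -
  obtain C where "C \<subseteq> cube n" "card C = M"
    using exists_superset_card[of "{}" "cube n" M] assms(2) by auto
  then have "bool_funs n M \<noteq> {}" unfolding bool_funs_eq by blast
  then have "max_stab n \<zeta> M \<in> noise_stab n \<zeta> ` bool_funs n M"
    unfolding max_stab_def by (intro Max_in) (auto simp: finite_bool_funs)
  then obtain A where "A \<subseteq> cube n" "card A = M"
      "max_stab n \<zeta> M = noise_stab n \<zeta> (restrict (indicator A) (cube n))"
    unfolding bool_funs_eq by blast
  then show ?thesis unfolding noise_stab_restrict[OF assms(1)] by blast
qed

text \<open>A set with fewer than \<open>M\<close> points is enlarged, which cannot decrease
  stability. The slack is needed because sets lifted from a lower dimension may fall short of the
  rounded volume.\<close>

lemma max_stab_ge:
  assumes "set_pmf \<zeta> \<subseteq> cube n" "A \<subseteq> cube n" "card A \<le> M" "M \<le> 2 ^ n"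
  shows "noise_stab n \<zeta> (indicator A) \<le> max_stab n \<zeta> M"
proof -
  obtain C where C: "A \<subseteq> C" "C \<subseteq> cube n" "card C = M"
    using exists_superset_card[OF assms(2), of M] assms by auto
  have "noise_stab n \<zeta> (indicator A) \<le> noise_stab n \<zeta> (indicator C)"
    using C(1) by (intro noise_stab_mono[OF assms(1)]) (auto simp: indicator_def)
  also have "\<dots> = noise_stab n \<zeta> (restrict (indicator C) (cube n))"
    by (simp add: noise_stab_restrict[OF assms(1)])
  also have "\<dots> \<le> max_stab n \<zeta> M"
    unfolding max_stab_def using C finite_bool_funs[of n M]
    by (intro Max_ge) (auto simp: bool_funs_eq)
  finally show ?thesis .
qed

section \<open>Rounded volumes and the limit for independent noise\<close>

lemma real_vol_le: "0 \<le> \<alpha> \<Longrightarrow> real (vol \<alpha> n) \<le> \<alpha> * 2 ^ n"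
  unfolding vol_def by (intro of_nat_floor) simp

lemma le_volI: "real k \<le> \<alpha> * 2 ^ n \<Longrightarrow> k \<le> vol \<alpha> n"
  unfolding vol_def by (rule le_nat_floor)

lemma vol_le:
  assumes "0 \<le> \<alpha>" "\<alpha> \<le> 1"
  shows "vol \<alpha> n \<le> 2 ^ n"
proof -
  have "real (vol \<alpha> n) \<le> 1 * 2 ^ n"
    by (rule order.trans[OF real_vol_le mult_right_mono]) (use assms in auto)
  then have "real (vol \<alpha> n) \<le> real (2 ^ n)" by simp
  then show ?thesis by (simp only: of_nat_le_iff)
qed

lemma vol_mult_le:
  assumes "0 \<le> \<alpha>" "m \<le> n"
  shows "vol \<alpha> m * 2 ^ (n - m) \<le> vol \<alpha> n"
proof (rule le_volI)
  have "real (vol \<alpha> m) * 2 ^ (n - m) \<le> \<alpha> * 2 ^ m * 2 ^ (n - m)"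
    using real_vol_le[OF assms(1)] by (intro mult_right_mono) auto
  also have "\<dots> = \<alpha> * 2 ^ n" using assms(2) by (simp add: power_add[symmetric] mult.assoc)
  finally show "real (vol \<alpha> m * 2 ^ (n - m)) \<le> \<alpha> * 2 ^ n" by simp
qed

text \<open>Here \<open>k\<close> stands for the size of the even part of a cylinder over a set of
  \<open>vol (2 * \<alpha>) m\<close> points.\<close>

lemma vol_double_mult_le:
  assumes "0 \<le> \<alpha>" "m < n" "2 * k = vol (2 * \<alpha>) m * 2 ^ (n - m)"
  shows "k \<le> vol \<alpha> n"
proof (rule le_volI)
  have "2 * real k = real (vol (2 * \<alpha>) m * 2 ^ (n - m))"
    unfolding assms(3)[symmetric] by simp
  also have "\<dots> \<le> real (vol (2 * \<alpha>) n)"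
    unfolding of_nat_le_iff by (rule vol_mult_le) (use assms in auto)
  also have "\<dots> \<le> 2 * \<alpha> * 2 ^ n" by (rule real_vol_le) (use assms in simp)
  finally show "real k \<le> \<alpha> * 2 ^ n" by simp
qed

lemma noise_stab_le_1:
  assumes "set_pmf \<zeta> \<subseteq> cube n" "\<And>x. x \<in> cube n \<Longrightarrow> \<bar>f x\<bar> \<le> 1"
  shows "noise_stab n \<zeta> f \<le> 1"
  using noise_stab_mono[OF assms(1), of f "\<lambda>_. 1"] assms(2) by (simp add: noise_stab_def case_prod_unfold)

lemma GammaN_IID_attained:
  assumes "0 \<le> \<alpha>" "\<alpha> \<le> 1"
  shows "\<exists>A\<subseteq>cube n. card A = vol \<alpha> n \<and> GammaN_IID n (vol \<alpha> n) \<beta> = Stab n \<beta> (indicator A)"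
  unfolding GammaN_IID_eq Stab_def
  by (rule max_stab_attained[OF set_pmf_iid_noise vol_le[OF assms]])

text \<open>The cylinder over an optimal set has the same stability in the next dimension and is
  small enough to compete there.\<close>

lemma GammaN_IID_incseq:
  assumes "0 \<le> \<alpha>" "\<alpha> \<le> 1" "0 \<le> \<beta>" "\<beta> \<le> 1"
  shows "incseq (\<lambda>n. GammaN_IID n (vol \<alpha> n) \<beta>)"
proof (rule incseq_SucI)
  fix n
  obtain A where A: "A \<subseteq> cube n" "card A = vol \<alpha> n" "GammaN_IID n (vol \<alpha> n) \<beta> = Stab n \<beta> (indicator A)"
    using GammaN_IID_attained[OF assms(1,2)] by blast
  have "GammaN_IID n (vol \<alpha> n) \<beta> = Stab (Suc n) \<beta> (indicator (cylinder n (Suc n) A))"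
    using A(3) Stab_cylinder[of n "Suc n" \<beta> A] assms by simp
  also have "\<dots> \<le> GammaN_IID (Suc n) (vol \<alpha> (Suc n)) \<beta>"
    unfolding Stab_def GammaN_IID_eq
  proof (rule max_stab_ge[OF set_pmf_iid_noise cylinder_subset])
    show "card (cylinder n (Suc n) A) \<le> vol \<alpha> (Suc n)"
      using card_cylinder[OF _ A(1), of "Suc n"] vol_mult_le[OF assms(1), of n "Suc n"] A(2) by simp
  qed (rule vol_le[OF assms(1,2)])
  finally show "GammaN_IID n (vol \<alpha> n) \<beta> \<le> GammaN_IID (Suc n) (vol \<alpha> (Suc n)) \<beta>" .
qed

lemma
  assumes "0 \<le> \<alpha>" "\<alpha> \<le> 1" "0 \<le> \<beta>" "\<beta> \<le> 1"
  shows GammaN_IID_LIMSEQ: "(\<lambda>n. GammaN_IID n (vol \<alpha> n) \<beta>) \<longlonglongrightarrow> Gamma_IID \<alpha> \<beta>"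
    and GammaN_IID_le: "GammaN_IID n (vol \<alpha> n) \<beta> \<le> Gamma_IID \<alpha> \<beta>"
proof -
  have "GammaN_IID n (vol \<alpha> n) \<beta> \<le> 1" for n
  proof -
    obtain A where "GammaN_IID n (vol \<alpha> n) \<beta> = Stab n \<beta> (indicator A)"
      using GammaN_IID_attained[OF assms(1,2)] by blast
    then show ?thesis
      unfolding Stab_def using noise_stab_le_1[OF set_pmf_iid_noise, of n "indicator A" \<beta>]
      by (simp add: indicator_def)
  qed
  then obtain L where "(\<lambda>n. GammaN_IID n (vol \<alpha> n) \<beta>) \<longlonglongrightarrow> L"
    using incseq_convergent[OF GammaN_IID_incseq[OF assms]] by blast
  then show lim: "(\<lambda>n. GammaN_IID n (vol \<alpha> n) \<beta>) \<longlonglongrightarrow> Gamma_IID \<alpha> \<beta>"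
    unfolding Gamma_IID_def by (simp add: limI)
  show "GammaN_IID n (vol \<alpha> n) \<beta> \<le> Gamma_IID \<alpha> \<beta>"
    by (rule incseq_le[OF GammaN_IID_incseq[OF assms] lim])
qed

text \<open>As \<open>\<beta> \<le> 1 / 2\<close>, all terms of the Fourier expansion are
  nonnegative.\<close>

lemma Stab_nonneg:
  assumes "0 \<le> \<beta>" "\<beta> \<le> 1 / 2"
  shows "Stab n \<beta> f \<ge> 0"
proof -
  have "\<beta> \<le> 1" using assms by simp
  then show ?thesis
    by (simp only: Stab_fourier[OF assms(1)], intro sum_nonneg mult_nonneg_nonneg) (use assms in auto)
qed

section \<open>Asymptotic bounds for a sequence of exchangeable noises\<close>

text \<open>Shared by spheres and balls of either parity. Exchangeability is asked only eventually:
  for \<open>n = 0\<close> the odd radius is 1 and the sphere is empty.\<close>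

locale noise_sequence =
  fixes \<zeta> :: "nat \<Rightarrow> (nat \<Rightarrow> int) pmf" and \<alpha> \<beta> :: real
  assumes ex: "\<forall>\<^sub>F n in sequentially. exchangeable n (\<zeta> n)"
    and dev: "(\<lambda>n. mean_deviation n (\<zeta> n) (1 - 2 * \<beta>)) \<longlonglongrightarrow> 0"
    and \<alpha>: "0 < \<alpha>" "\<alpha> \<le> 1 / 2" and \<beta>: "0 < \<beta>" "\<beta> \<le> 1 / 2"
begin

abbreviation parity_mean :: "nat \<Rightarrow> real" where
  "parity_mean n \<equiv> chi_mean (\<zeta> n) {..<n}"

text \<open>A set that is nearly optimal for independent noise in a fixed dimension \<open>m\<close>
  is lifted to dimension \<open>n\<close>. Its parity term decays as \<open>n\<close> grows. The
  approximation of the limit, the parity term and the uniform error cost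
  \<open>\<epsilon> / 3\<close> each.\<close>

lemma max_stab_lower:
  assumes "\<epsilon> > 0"
  shows "\<forall>\<^sub>F n in sequentially. Gamma_IID \<alpha> \<beta> - \<epsilon> \<le> max_stab n (\<zeta> n) (vol \<alpha> n)"
proof -
  have \<epsilon>: "\<epsilon> / 3 > 0" using assms by simp
  have \<alpha>': "0 \<le> \<alpha>" "\<alpha> \<le> 1" and \<beta>': "0 \<le> \<beta>" "\<beta> \<le> 1" using \<alpha> \<beta> by auto
  have "\<forall>\<^sub>F n in sequentially. Gamma_IID \<alpha> \<beta> - \<epsilon> / 3 < GammaN_IID n (vol \<alpha> n) \<beta>"
    by (rule order_tendstoD(1)[OF GammaN_IID_LIMSEQ[OF \<alpha>' \<beta>']]) (use assms in simp)
  then obtain m where m: "Gamma_IID \<alpha> \<beta> - \<epsilon> / 3 < GammaN_IID m (vol \<alpha> m) \<beta>"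
    by (auto simp: eventually_sequentially)
  obtain A where A: "A \<subseteq> cube m" "card A = vol \<alpha> m" "GammaN_IID m (vol \<alpha> m) \<beta> = Stab m \<beta> (indicator A)"
    using GammaN_IID_attained[OF \<alpha>'] by blast
  obtain k where k: "(1 - 2 * \<beta>) ^ k < \<epsilon> / 3"
    using real_arch_pow_inv[OF \<epsilon>, of "1 - 2 * \<beta>"] \<beta> by auto
  show ?thesis
    using noise_stab_uniform[OF ex dev \<beta> \<epsilon>] ex eventually_ge_at_top[of "m + k"]
  proof eventually_elim
    case (elim n)
    note supp = exchangeable_support[OF elim(2)]
    let ?f = "indicator (cylinder m n A) :: _ \<Rightarrow> real"
    have mn: "m \<le> n" using elim(3) by simp
    have "(1 - 2 * \<beta>) ^ (n - m) \<le> (1 - 2 * \<beta>) ^ k"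
      using \<beta> elim(3) by (intro power_decreasing) auto
    then have "Stab n \<beta> (\<lambda>x. ?f x * chi {..<n} x) \<le> \<epsilon> / 3"
      using Stab_cylinder_mult_chi_full[OF mn \<beta>'(1) \<beta>(2), of A] k by linarith
    moreover have "Stab n \<beta> (\<lambda>x. ?f x * chi {..<n} x) \<ge> 0"
      by (rule Stab_nonneg) (use \<beta> in auto)
    moreover have "\<bar>parity_mean n\<bar> \<le> 1" by (rule abs_chi_mean_le_1[OF supp]) simp
    ultimately have "\<bar>parity_mean n * Stab n \<beta> (\<lambda>x. ?f x * chi {..<n} x)\<bar> \<le> 1 * (\<epsilon> / 3)"
      unfolding abs_mult by (intro mult_mono) auto
    moreover have "\<bar>noise_stab n (\<zeta> n) ?f - Stab n \<beta> ?f -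
        parity_mean n * Stab n \<beta> (\<lambda>x. ?f x * chi {..<n} x)\<bar> \<le> \<epsilon> / 3"
      by (rule elim(1)[rule_format]) (simp add: indicator_def)
    moreover have "Stab n \<beta> ?f = GammaN_IID m (vol \<alpha> m) \<beta>"
      unfolding A(3) by (rule Stab_cylinder[OF mn \<beta>'])
    moreover have "noise_stab n (\<zeta> n) ?f \<le> max_stab n (\<zeta> n) (vol \<alpha> n)"
    proof (rule max_stab_ge[OF supp cylinder_subset])
      show "card (cylinder m n A) \<le> vol \<alpha> n"
        unfolding card_cylinder[OF mn A(1)] A(2) by (rule vol_mult_le[OF \<alpha>'(1) mn])
    qed (rule vol_le[OF \<alpha>'])
    ultimately show ?case using m by linarith
  qed
qed

text \<open>For an optimal set, both stabilities in the uniform expansion lie between 0 and the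
  limit value. A negative parity mean can therefore be replaced by 0.\<close>

lemma max_stab_upper:
  assumes "\<epsilon> > 0"
  shows "\<forall>\<^sub>F n in sequentially.
    max_stab n (\<zeta> n) (vol \<alpha> n) \<le> (1 + max 0 (parity_mean n)) * Gamma_IID \<alpha> \<beta> + \<epsilon>"
  using noise_stab_uniform[OF ex dev \<beta> assms] ex
proof eventually_elim
  case (elim n)
  note supp = exchangeable_support[OF elim(2)]
  have \<alpha>': "0 \<le> \<alpha>" "\<alpha> \<le> 1" and \<beta>': "0 \<le> \<beta>" "\<beta> \<le> 1" using \<alpha> \<beta> by auto
  obtain A where A: "A \<subseteq> cube n" "card A = vol \<alpha> n"
    "max_stab n (\<zeta> n) (vol \<alpha> n) = noise_stab n (\<zeta> n) (indicator A)"
    using max_stab_attained[OF supp vol_le[OF \<alpha>']] by blast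
  let ?f = "indicator A :: _ \<Rightarrow> real" and ?c = "parity_mean n"
  let ?g = "\<lambda>x. ?f x * chi {..<n} x"
  have "Stab n \<beta> ?f \<le> GammaN_IID n (vol \<alpha> n) \<beta>"
    unfolding Stab_def GammaN_IID_eq
    by (rule max_stab_ge[OF set_pmf_iid_noise A(1)]) (use A(2) vol_le[OF \<alpha>'] in auto)
  then have 1: "Stab n \<beta> ?f \<le> Gamma_IID \<alpha> \<beta>"
    using GammaN_IID_le[OF \<alpha>' \<beta>', of n] by linarith
  have "Stab n \<beta> ?g \<le> Stab n \<beta> ?f"
    unfolding Stab_def using abs_chi[of _ n "{..<n}"]
    by (intro noise_stab_mono[OF set_pmf_iid_noise]) (auto simp: indicator_def)
  then have 2: "Stab n \<beta> ?g \<le> Gamma_IID \<alpha> \<beta>" using 1 by linarith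
  have 3: "Stab n \<beta> ?g \<ge> 0" by (rule Stab_nonneg) (use \<beta> in auto)
  have "?c * Stab n \<beta> ?g \<le> max 0 ?c * Stab n \<beta> ?g"
    using 3 by (intro mult_right_mono) auto
  also have "\<dots> \<le> max 0 ?c * Gamma_IID \<alpha> \<beta>"
    using 2 by (intro mult_left_mono) auto
  finally have "?c * Stab n \<beta> ?g \<le> max 0 ?c * Gamma_IID \<alpha> \<beta>" .
  moreover have "\<bar>noise_stab n (\<zeta> n) ?f - Stab n \<beta> ?f - ?c * Stab n \<beta> ?g\<bar> \<le> \<epsilon>"
    by (rule elim(1)[rule_format]) (simp add: indicator_def)
  ultimately show ?case unfolding A(3) distrib_right using 1 by linarith
qed

text \<open>The even part of a cylinder of volume about \<open>2 * \<alpha>\<close> has volume about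
  \<open>\<alpha>\<close>. The parity character is 1 on it and the parity mean is 1, so the two main
  terms coincide. Each is at least a quarter of the stability of the underlying set, which gives one
  half in total.\<close>

lemma max_stab_lower_even:
  assumes c: "\<forall>\<^sub>F n in sequentially. parity_mean n = 1" and "\<epsilon> > 0"
  shows "\<forall>\<^sub>F n in sequentially. 1 / 2 * Gamma_IID (2 * \<alpha>) \<beta> - \<epsilon> \<le> max_stab n (\<zeta> n) (vol \<alpha> n)"
proof -
  have \<epsilon>: "\<epsilon> / 2 > 0" using \<open>\<epsilon> > 0\<close> by simp
  have \<alpha>': "0 \<le> \<alpha>" "\<alpha> \<le> 1" and \<alpha>2: "0 \<le> 2 * \<alpha>" "2 * \<alpha> \<le> 1" and \<beta>': "0 \<le> \<beta>" "\<beta> \<le> 1"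
    using \<alpha> \<beta> by auto
  \<comment> \<open>The full \<open>\<epsilon>\<close> is affordable here, since this value later
    enters with factor 1/2; the other half of the budget goes to the uniform error.\<close>
  have "\<forall>\<^sub>F n in sequentially. Gamma_IID (2 * \<alpha>) \<beta> - \<epsilon> < GammaN_IID n (vol (2 * \<alpha>) n) \<beta>"
    by (rule order_tendstoD(1)[OF GammaN_IID_LIMSEQ[OF \<alpha>2 \<beta>']]) (use \<open>\<epsilon> > 0\<close> in simp)
  then obtain m where m: "Gamma_IID (2 * \<alpha>) \<beta> - \<epsilon> < GammaN_IID m (vol (2 * \<alpha>) m) \<beta>"
    by (auto simp: eventually_sequentially)
  obtain A where A: "A \<subseteq> cube m" "card A = vol (2 * \<alpha>) m"
      "GammaN_IID m (vol (2 * \<alpha>) m) \<beta> = Stab m \<beta> (indicator A)"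
    using GammaN_IID_attained[OF \<alpha>2] by blast
  show ?thesis
    using noise_stab_uniform[OF ex dev \<beta> \<epsilon>] ex c eventually_gt_at_top[of m]
  proof eventually_elim
    case (elim n)
    note supp = exchangeable_support[OF elim(2)]
    let ?E = "even_part n (cylinder m n A)"
    have sub: "?E \<subseteq> cube n" using cylinder_subset by (auto simp: even_part_def)
    have "(\<lambda>x. indicator ?E x * chi {..<n} x) = (indicator ?E :: _ \<Rightarrow> real)"
      by (auto simp: even_part_def indicator_def)
    then have "\<bar>noise_stab n (\<zeta> n) (indicator ?E) - Stab n \<beta> (indicator ?E) - Stab n \<beta> (indicator ?E)\<bar> \<le> \<epsilon> / 2"
      using elim(1)[rule_format, of "indicator ?E"] elim(3) by simp
    moreover have "Stab n \<beta> (indicator ?E) \<ge> GammaN_IID m (vol (2 * \<alpha>) m) \<beta> / 4"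
      unfolding A(3) by (rule Stab_even_part_cylinder[OF elim(4) \<beta>'(1) \<beta>(2)])
    moreover have "noise_stab n (\<zeta> n) (indicator ?E) \<le> max_stab n (\<zeta> n) (vol \<alpha> n)"
    proof (rule max_stab_ge[OF supp sub])
      have "2 * card ?E = vol (2 * \<alpha>) m * 2 ^ (n - m)"
        using card_even_part_cylinder[OF elim(4) A(1)] card_cylinder[OF _ A(1), of n] elim(4) A(2)
        by simp
      then show "card ?E \<le> vol \<alpha> n" by (rule vol_double_mult_le[OF \<alpha>'(1) elim(4)])
    qed (rule vol_le[OF \<alpha>'])
    ultimately show ?case using m by linarith
  qed
qed

lemma max_stab_upper_limit:
  assumes c: "parity_mean \<longlonglongrightarrow> c" and "\<epsilon> > 0"
  shows "\<forall>\<^sub>F n in sequentially.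
    max_stab n (\<zeta> n) (vol \<alpha> n) \<le> (1 + max 0 c) * Gamma_IID \<alpha> \<beta> + \<epsilon>"
proof -
  have "(\<lambda>n. (1 + max 0 (parity_mean n)) * Gamma_IID \<alpha> \<beta>) \<longlonglongrightarrow> (1 + max 0 c) * Gamma_IID \<alpha> \<beta>"
    by (intro tendsto_intros tendsto_max c)
  then have "\<forall>\<^sub>F n in sequentially. (1 + max 0 (parity_mean n)) * Gamma_IID \<alpha> \<beta> <
      (1 + max 0 c) * Gamma_IID \<alpha> \<beta> + \<epsilon> / 2"
    by (rule order_tendstoD(2)) (use \<open>\<epsilon> > 0\<close> in simp)
  moreover have "\<epsilon> / 2 > 0" using \<open>\<epsilon> > 0\<close> by simp
  note max_stab_upper[OF this]
  ultimately show ?thesis by eventually_elim linarith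
qed

text \<open>For a nonpositive limit of the parity means, the factor in the upper bound is 1 and the
  two bounds meet.\<close>

lemma max_stab_LIMSEQ:
  assumes c: "parity_mean \<longlonglongrightarrow> c" and "c \<le> 0"
  shows "(\<lambda>n. max_stab n (\<zeta> n) (vol \<alpha> n)) \<longlonglongrightarrow> Gamma_IID \<alpha> \<beta>"
proof (rule tendstoI)
  fix \<epsilon> :: real assume "\<epsilon> > 0"
  then have "\<epsilon> / 2 > 0" by simp
  show "\<forall>\<^sub>F n in sequentially. dist (max_stab n (\<zeta> n) (vol \<alpha> n)) (Gamma_IID \<alpha> \<beta>) < \<epsilon>"
    using max_stab_upper_limit[OF c \<open>\<epsilon> / 2 > 0\<close>] max_stab_lower[OF \<open>\<epsilon> / 2 > 0\<close>]
  proof eventually_elim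
    case (elim n)
    have "(1 + max 0 c) * Gamma_IID \<alpha> \<beta> = Gamma_IID \<alpha> \<beta>" using \<open>c \<le> 0\<close> by simp
    then show ?case using elim \<open>\<epsilon> > 0\<close> unfolding dist_real_def by linarith
  qed
qed

end

lemma le_liminf_ereal:
  fixes x :: "nat \<Rightarrow> real"
  assumes "\<And>\<epsilon>. \<epsilon> > 0 \<Longrightarrow> \<forall>\<^sub>F n in sequentially. a - \<epsilon> \<le> x n"
  shows "ereal a \<le> liminf (\<lambda>n. ereal (x n))"
proof (rule ereal_le_epsilon2)
  fix \<epsilon> :: real assume "\<epsilon> > 0"
  have "ereal (a - \<epsilon>) \<le> liminf (\<lambda>n. ereal (x n))"
    by (rule Liminf_bounded) (use assms[OF \<open>\<epsilon> > 0\<close>] in simp)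
  then have "ereal (a - \<epsilon>) + ereal \<epsilon> \<le> liminf (\<lambda>n. ereal (x n)) + ereal \<epsilon>"
    by (rule add_right_mono)
  then show "ereal a \<le> liminf (\<lambda>n. ereal (x n)) + ereal \<epsilon>" by simp
qed

lemma limsup_le_ereal:
  fixes x :: "nat \<Rightarrow> real"
  assumes "\<And>\<epsilon>. \<epsilon> > 0 \<Longrightarrow> \<forall>\<^sub>F n in sequentially. x n \<le> a + \<epsilon>"
  shows "limsup (\<lambda>n. ereal (x n)) \<le> ereal a"
proof (rule ereal_le_epsilon2)
  fix \<epsilon> :: real assume "\<epsilon> > 0"
  have "limsup (\<lambda>n. ereal (x n)) \<le> ereal (a + \<epsilon>)"
    by (rule Limsup_bounded) (use assms[OF \<open>\<epsilon> > 0\<close>] in simp)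
  then show "limsup (\<lambda>n. ereal (x n)) \<le> ereal a + ereal \<epsilon>" by simp
qed

section \<open>Spheres and balls\<close>

abbreviation weight :: "nat \<Rightarrow> (nat \<Rightarrow> int) \<Rightarrow> nat" where
  "weight n z \<equiv> hamming n z (ones n)"

lemma weight_eq: "weight n z = card {i\<in>{..<n}. z i \<noteq> 1}"
  unfolding hamming_def by (rule arg_cong[where f = card]) (auto simp: ones_def)

lemma sum_coords:
  assumes "z \<in> cube n"
  shows "(\<Sum>i<n. real_of_int (z i)) = real n - 2 * real (weight n z)"
proof -
  have "(\<Sum>i<n. real_of_int (z i)) = (\<Sum>i<n. 1 - 2 * of_bool (z i \<noteq> 1))"
    by (intro sum.cong refl) (use cube_values[OF assms] in fastforce)
  also have "\<dots> = real n - 2 * (\<Sum>i<n. of_bool (z i \<noteq> 1))"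
    by (simp add: sum_subtractf sum_distrib_left)
  also have "(\<Sum>i<n. of_bool (z i \<noteq> 1)) = real (weight n z)"
    unfolding weight_eq by (simp add: of_bool_def sum.If_cases Int_def)
  finally show ?thesis .
qed

lemma chi_full_eq:
  assumes "z \<in> cube n"
  shows "chi {..<n} z = (-1) ^ weight n z"
proof -
  have "chi {..<n} z = (\<Prod>i<n. if z i \<noteq> 1 then -1 else 1)"
    unfolding chi_def by (intro prod.cong refl) (use cube_values[OF assms] in fastforce)
  also have "\<dots> = (-1) ^ weight n z"
    unfolding weight_eq by (simp add: prod.If_cases Int_def)
  finally show ?thesis .
qed

lemma weight_comp_permutes:
  assumes "\<pi> permutes {..<n}"
  shows "weight n (z \<circ> \<pi>) = weight n z"
proof -
  have "bij_betw \<pi> {i\<in>{..<n}. z (\<pi> i) \<noteq> 1} {i\<in>{..<n}. z i \<noteq> 1}"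
  proof (rule bij_betw_imageI)
    show "inj_on \<pi> {i\<in>{..<n}. z (\<pi> i) \<noteq> 1}"
      using permutes_inj[OF assms] by (rule inj_on_subset) simp
    show "\<pi> ` {i\<in>{..<n}. z (\<pi> i) \<noteq> 1} = {i\<in>{..<n}. z i \<noteq> 1}"
    proof (intro equalityI subsetI)
      fix j assume j: "j \<in> {i\<in>{..<n}. z i \<noteq> 1}"
      then have "j \<in> \<pi> ` {..<n}" using permutes_image[OF assms] by simp
      then show "j \<in> \<pi> ` {i\<in>{..<n}. z (\<pi> i) \<noteq> 1}" using j by auto
    qed (use permutes_in_image[OF assms] in auto)
  qed
  then show ?thesis unfolding weight_eq by (simp add: bij_betw_same_card)
qed

text \<open>Permuting coordinates preserves the weight, on which membership in \<open>S\<close>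
  depends within the cube. The inverse permutation is needed to see that points outside the cube
  stay outside.\<close>

lemma exchangeable_pmf_of_set:
  assumes "S = {z \<in> cube n. P (weight n z)}" "S \<noteq> {}"
  shows "exchangeable n (pmf_of_set S)"
  unfolding exchangeable_def
proof (intro conjI allI impI)
  have fin: "finite S" using assms(1) by simp
  show "set_pmf (pmf_of_set S) \<subseteq> cube n"
    using assms fin by auto
  fix \<pi> z assume \<pi>: "\<pi> permutes {..<n}"
  have "z \<in> cube n" if "z \<circ> \<pi> \<in> cube n"
    using comp_permutes_in_cube[OF permutes_inv[OF \<pi>] that]
    by (simp add: comp_assoc permutes_inv_o(1)[OF \<pi>])
  then have "z \<circ> \<pi> \<in> S \<longleftrightarrow> z \<in> S"
    using comp_permutes_in_cube[OF \<pi>] weight_comp_permutes[OF \<pi>, of z] assms(1) by auto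
  then show "pmf (pmf_of_set S) (z \<circ> \<pi>) = pmf (pmf_of_set S) z"
    using assms(2) fin by (simp add: indicator_def)
qed

lemma card_hsphere: "card (hsphere n r) = n choose r"
proof -
  have "bij_betw (\<lambda>z. {i\<in>{..<n}. z i \<noteq> 1}) (hsphere n r) {A. A \<subseteq> {..<n} \<and> card A = r}"
  proof (rule bij_betwI[where g = "\<lambda>A. \<lambda>i\<in>{..<n}. if i \<in> A then -1 else 1"])
    fix z assume "z \<in> hsphere n r"
    then have z: "z \<in> cube n" by (simp add: hsphere_def)
    show "(\<lambda>i\<in>{..<n}. if i \<in> {i\<in>{..<n}. z i \<noteq> 1} then -1 else 1) = z"
    proof (rule cube_ext[OF _ z])
      show "(\<lambda>i\<in>{..<n}. if i \<in> {i\<in>{..<n}. z i \<noteq> 1} then -1 else 1) \<in> cube n"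
        by (auto simp: cube_def)
    qed (use cube_values[OF z] in fastforce)
  next
    show "(\<lambda>A. \<lambda>i\<in>{..<n}. if i \<in> A then -1 else 1) \<in> {A. A \<subseteq> {..<n} \<and> card A = r} \<rightarrow> hsphere n r"
    proof (intro funcsetI)
      fix A assume A: "A \<in> {A. A \<subseteq> {..<n} \<and> card A = r}"
      have "{i\<in>{..<n}. (\<lambda>i\<in>{..<n}. if i \<in> A then -1 else 1 :: int) i \<noteq> 1} = A" using A by auto
      then show "(\<lambda>i\<in>{..<n}. if i \<in> A then -1 else 1) \<in> hsphere n r"
        using A unfolding hsphere_def weight_eq by (auto simp: cube_def)
    qed
  qed (auto simp: hsphere_def weight_eq)
  then show ?thesis using n_subsets[of "{..<n}" r] by (simp add: bij_betw_same_card)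
qed

lemma finite_hsphere [simp]: "finite (hsphere n r)"
  and finite_hball [simp]: "finite (hball n r)"
  by (simp_all add: hsphere_def hball_def)

lemma hsphere_nonempty: "r \<le> n \<Longrightarrow> hsphere n r \<noteq> {}"
  using card_hsphere[of n r] zero_less_binomial[of r n] by auto

lemma hball_nonempty: "hball n r \<noteq> {}"
  using hsphere_nonempty[of 0 n] by (auto simp: hsphere_def hball_def)

lemma sum_hball:
  fixes g :: "nat \<Rightarrow> real"
  shows "(\<Sum>z\<in>hball n r. g (weight n z)) = (\<Sum>s\<le>r. real (n choose s) * g s)"
proof -
  have "(\<Sum>z\<in>hball n r. g (weight n z)) =
      (\<Sum>s\<le>r. \<Sum>z\<in>{z \<in> hball n r. weight n z = s}. g (weight n z))"
    by (rule sum.group[symmetric]) (auto simp: hball_def)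
  also have "\<dots> = (\<Sum>s\<le>r. \<Sum>z\<in>hsphere n s. g s)"
    by (intro sum.cong) (auto simp: hball_def hsphere_def)
  finally show ?thesis by (simp add: card_hsphere)
qed

lemma exchangeable_hsphere: "r \<le> n \<Longrightarrow> exchangeable n (pmf_of_set (hsphere n r))"
  by (rule exchangeable_pmf_of_set[where P = "\<lambda>s. s = r", OF hsphere_def hsphere_nonempty])

lemma exchangeable_hball: "exchangeable n (pmf_of_set (hball n r))"
  by (rule exchangeable_pmf_of_set[where P = "\<lambda>s. s \<le> r", OF hball_def hball_nonempty])

section \<open>Uniform noise on a sphere\<close>

lemma hsphere_expectation:
  fixes g :: "_ \<Rightarrow> real"
  assumes "r \<le> n" "\<And>z. z \<in> hsphere n r \<Longrightarrow> g z = c"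
  shows "measure_pmf.expectation (pmf_of_set (hsphere n r)) g = c"
proof -
  have "measure_pmf.expectation (pmf_of_set (hsphere n r)) g = (\<Sum>z\<in>hsphere n r. c) / card (hsphere n r)"
    using assms hsphere_nonempty[OF assms(1)] by (simp add: integral_pmf_of_set)
  then show ?thesis using hsphere_nonempty[OF assms(1)] by simp
qed

lemma hsphere_parity: "r \<le> n \<Longrightarrow> chi_mean (pmf_of_set (hsphere n r)) {..<n} = (-1) ^ r"
  by (rule hsphere_expectation) (auto simp: hsphere_def chi_full_eq)

lemma hsphere_mean_deviation:
  assumes "r \<le> n"
  shows "mean_deviation n (pmf_of_set (hsphere n r)) b = \<bar>(real n - 2 * real r) / real n - b\<bar>"
  unfolding mean_deviation_def
  by (rule hsphere_expectation[OF assms]) (auto simp: hsphere_def sum_coords)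

section \<open>Uniform noise on a ball: moments of the coordinate sum\<close>

definition ball_size :: "nat \<Rightarrow> nat \<Rightarrow> real" where
  "ball_size n r = (\<Sum>s\<le>r. real (n choose s))"

text \<open>The expected coordinate sum of a uniform point of the Hamming ball.\<close>
definition ball_bias :: "nat \<Rightarrow> nat \<Rightarrow> real" where
  "ball_bias n r = (real n - real r) * real (n choose r) / ball_size n r"

lemma ball_size_pos: "ball_size n r > 0"
proof -
  have "ball_size n r \<ge> (\<Sum>s\<in>{0}. real (n choose s))"
    unfolding ball_size_def by (rule sum_mono2) auto
  then show ?thesis by simp
qed

lemma hball_expectation:
  fixes g :: "nat \<Rightarrow> real"
  assumes "\<And>z. z \<in> hball n r \<Longrightarrow> f z = g (weight n z)"
  shows "measure_pmf.expectation (pmf_of_set (hball n r)) f =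
    (\<Sum>s\<le>r. real (n choose s) * g s) / ball_size n r"
proof -
  have "real (card (hball n r)) = ball_size n r"
    using sum_hball[of "\<lambda>_. 1" n r] by (simp add: ball_size_def)
  moreover have "(\<Sum>z\<in>hball n r. f z) = (\<Sum>s\<le>r. real (n choose s) * g s)"
    using assms by (simp add: sum_hball[symmetric])
  ultimately show ?thesis by (simp add: integral_pmf_of_set hball_nonempty)
qed

text \<open>The recurrence behind the inductions on \<open>r\<close> for the following three partial
  sums of binomial coefficients.\<close>

lemma Suc_times_choose_Suc:
  "(1 + real r) * real (n choose Suc r) = (real n - real r) * real (n choose r)"
proof (cases "r \<le> n")
  case True
  have "Suc r * (n choose Suc r) = (n - r) * (n choose r)"
    by (rule binomial_absorb_comp[symmetric, of n r, unfolded binomial_absorption[symmetric]])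
  then have "real (Suc r * (n choose Suc r)) = real ((n - r) * (n choose r))" by simp
  then show ?thesis using True by (simp add: of_nat_diff distrib_right)
next
  case False
  then show ?thesis by (simp add: binomial_eq_0)
qed

lemma sum_choose_bias:
  "(\<Sum>s\<le>r. real (n choose s) * (real n - 2 * real s)) = (real n - real r) * real (n choose r)"
proof (induction r)
  case (Suc r)
  then show ?case using Suc_times_choose_Suc[of r n] by (simp add: algebra_simps)
qed simp

text \<open>For \<open>n > 0\<close> the partial alternating sum is a signed binomial coefficient of
  \<open>n - 1\<close>. The factor \<open>n\<close> brings it to the same expression as in
  \<open>sum_choose_bias\<close>, so the parity mean of a ball is, up to sign, its mean
  coordinate.\<close>

lemma sum_choose_parity:
  "real n * (\<Sum>s\<le>r. real (n choose s) * (-1) ^ s) = (-1) ^ r * ((real n - real r) * real (n choose r))"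
proof (induction r)
  case (Suc r)
  have "real n * (\<Sum>s\<le>Suc r. real (n choose s) * (-1) ^ s) =
      (-1) ^ r * ((1 + real r) * real (n choose Suc r)) - real n * real (n choose Suc r) * (-1) ^ r"
    using Suc Suc_times_choose_Suc[of r n] by (simp add: distrib_left right_diff_distrib)
  then show ?case by (simp add: algebra_simps)
qed simp

lemma sum_choose_bias_square:
  "(\<Sum>s\<le>r. real (n choose s) * (real n - 2 * real s)\<^sup>2) =
    real n * (\<Sum>s\<le>r. real (n choose s)) +
    (real n - 1 - 2 * real r) * ((real n - real r) * real (n choose r))"
proof (induction r)
  case (Suc r)
  have "(\<Sum>s\<le>Suc r. real (n choose s) * (real n - 2 * real s)\<^sup>2) =
      real n * (\<Sum>s\<le>r. real (n choose s)) +
      (real n - 1 - 2 * real r) * ((1 + real r) * real (n choose Suc r)) +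
      real (n choose Suc r) * (real n - 2 * real (Suc r))\<^sup>2"
    using Suc Suc_times_choose_Suc[of r n] by simp
  then show ?case by (simp add: algebra_simps power2_eq_square)
qed (simp add: algebra_simps power2_eq_square)

lemma hball_parity:
  assumes "n > 0"
  shows "chi_mean (pmf_of_set (hball n r)) {..<n} = (-1) ^ r * (ball_bias n r / real n)"
proof -
  have "chi_mean (pmf_of_set (hball n r)) {..<n} =
      (\<Sum>s\<le>r. real (n choose s) * (-1) ^ s) / ball_size n r"
    by (rule hball_expectation) (simp add: hball_def chi_full_eq)
  also have "(\<Sum>s\<le>r. real (n choose s) * (-1) ^ s) =
      (-1) ^ r * ((real n - real r) * real (n choose r)) / real n"
    using assms by (simp add: sum_choose_parity[symmetric])
  finally show ?thesis by (simp add: ball_bias_def)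
qed

text \<open>
  The first and second moments of the coordinate sum \<open>W\<close> are \<open>y = ball_bias n r\<close> and
  \<open>n + (n - 1 - 2 r) y\<close>; as \<open>W \<ge> n - 2 r\<close> on the ball, the inequality \<open>(E W)\<^sup>2 \<le> E W\<^sup>2\<close>
  forces \<open>y\<close> close to \<open>n - 2 r\<close>.
\<close>
lemma ball_bias_bounds:
  assumes "real r \<le> real n / 2 + 1" "r \<le> n"
  shows "real n - 2 * real r \<le> ball_bias n r"
    and "ball_bias n r - (real n - 2 * real r) \<le> sqrt (5 * real n)"
proof -
  let ?y = "ball_bias n r" and ?B = "ball_size n r" and ?W = "\<lambda>z. \<Sum>i<n. real_of_int (z i)"
  let ?E = "measure_pmf.expectation (pmf_of_set (hball n r))"
  define D where "D = ?y - (real n - 2 * real r)"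
  note B = ball_size_pos[of n r]
  have mean: "?E ?W = ?y"
    unfolding ball_bias_def sum_choose_bias[symmetric]
    by (rule hball_expectation) (simp add: hball_def sum_coords)
  have y: "?y * ?B = (\<Sum>s\<le>r. real (n choose s) * (real n - 2 * real s))"
    unfolding sum_choose_bias using B by (simp add: ball_bias_def)
  have "(real n - 2 * real r) * ?B \<le> ?y * ?B"
    unfolding y unfolding ball_size_def sum_distrib_left
    by (intro sum_mono) (simp add: mult.commute mult_left_mono)
  then show 1: "real n - 2 * real r \<le> ?y" using B by simp
  have "?y * ?B \<le> real n * ?B"
    unfolding y unfolding ball_size_def sum_distrib_left
    by (intro sum_mono) (simp add: mult.commute[of "real n"] mult_left_mono)
  then have "?y \<le> real n" using B by simp
  then have D: "0 \<le> D" "D \<le> 2 * real n" using 1 assms(2) by (auto simp: D_def)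
  have "?y \<ge> 0" using assms(2) B by (simp add: ball_bias_def)
  have "?E (\<lambda>z. (?W z)\<^sup>2) = (\<Sum>s\<le>r. real (n choose s) * (real n - 2 * real s)\<^sup>2) / ?B"
    by (rule hball_expectation) (simp add: hball_def sum_coords)
  also have "\<dots> = real n + (real n - 1 - 2 * real r) * ?y"
    unfolding sum_choose_bias_square ball_size_def[symmetric] using B
    by (simp add: ball_bias_def add_divide_distrib)
  finally have "?y\<^sup>2 \<le> real n + (real n - 1 - 2 * real r) * ?y"
    using expectation_square_le[OF exchangeable_support[OF exchangeable_hball], of n r ?W] mean
    by simp
  \<comment> \<open>This is the moment inequality rearranged, with the nonnegative term
    \<open>?y\<close> dropped.\<close>
  then have "?y * D \<le> real n" using \<open>?y \<ge> 0\<close>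
    by (simp add: D_def power2_eq_square algebra_simps)
  \<comment> \<open>The radius may exceed \<open>n / 2\<close> by 1, so \<open>n - 2 * r\<close> is
    only known to be at least -2. Then the square of \<open>D\<close> is at most
    \<open>n + 2 * D\<close>, and \<open>D \<le> 2 * n\<close> gives the constant 5.\<close>
  moreover have "- 2 * D \<le> (real n - 2 * real r) * D"
    using D(1) assms(1) by (intro mult_right_mono) auto
  moreover have "D\<^sup>2 = ?y * D - (real n - 2 * real r) * D"
    by (simp add: D_def power2_eq_square algebra_simps)
  ultimately have "D\<^sup>2 \<le> 5 * real n" using D(2) by linarith
  then show "?y - (real n - 2 * real r) \<le> sqrt (5 * real n)"
    unfolding D_def[symmetric] by (rule real_le_rsqrt)
qed

text \<open>On the ball the coordinate sum is never below \<open>n - 2 * r\<close>, so its distance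
  to that value needs no absolute value and has an explicit expectation.\<close>

lemma hball_mean_deviation:
  "mean_deviation n (pmf_of_set (hball n r)) b \<le>
    \<bar>(real n - 2 * real r) / real n - b\<bar> + (ball_bias n r - (real n - 2 * real r)) / real n"
proof -
  let ?E = "measure_pmf.expectation (pmf_of_set (hball n r))" and ?W = "\<lambda>z. \<Sum>i<n. real_of_int (z i)"
  let ?v = "real n - 2 * real r"
  have supp: "set_pmf (pmf_of_set (hball n r)) \<subseteq> cube n"
    by (rule exchangeable_support[OF exchangeable_hball])
  note int = integrable_cube_support[OF supp]
  have mean: "?E ?W = ball_bias n r"
    unfolding ball_bias_def sum_choose_bias[symmetric]
    by (rule hball_expectation) (simp add: hball_def sum_coords)
  have "mean_deviation n (pmf_of_set (hball n r)) b \<le> ?E (\<lambda>z. \<bar>?v / real n - b\<bar> + (?W z - ?v) / real n)"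
    unfolding mean_deviation_def
  proof (intro integral_mono_AE int AE_pmfI)
    fix z assume "z \<in> set_pmf (pmf_of_set (hball n r))"
    then have "z \<in> hball n r" by (simp add: hball_nonempty)
    then have z: "z \<in> cube n" "weight n z \<le> r" by (auto simp: hball_def)
    have "0 \<le> (?W z - ?v) / real n" using z by (simp add: sum_coords)
    moreover have "?W z / real n - b = (?v / real n - b) + (?W z - ?v) / real n"
      by (simp add: diff_divide_distrib)
    ultimately show "\<bar>?W z / real n - b\<bar> \<le> \<bar>?v / real n - b\<bar> + (?W z - ?v) / real n" by linarith
  qed
  also have "\<dots> = \<bar>?v / real n - b\<bar> + (?E ?W - ?v) / real n"
    by (simp add: int)
  finally show ?thesis unfolding mean .
qed

section \<open>Limits for radii within a bounded distance of \<beta> n\<close>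

context
  fixes r :: "nat \<Rightarrow> nat" and \<beta> :: real
  assumes r_lower: "\<And>n. \<beta> * real n - 2 \<le> real (r n)"
    and r_upper: "\<And>n. real (r n) \<le> \<beta> * real n + 1"
    and \<beta>: "0 < \<beta>" "\<beta> \<le> 1 / 2"
begin

lemma radius_bounds: "real (r n) \<le> real n / 2 + 1" "2 \<le> n \<Longrightarrow> r n \<le> n"
proof -
  have "\<beta> * real n \<le> 1 / 2 * real n" by (rule mult_right_mono[OF \<beta>(2)]) simp
  then show 1: "real (r n) \<le> real n / 2 + 1" using r_upper[of n] by simp
  show "r n \<le> n" if "2 \<le> n" using 1 that by linarith
qed

lemma radius_deviation:
  assumes "n > 0"
  shows "\<bar>(real n - 2 * real (r n)) / real n - (1 - 2 * \<beta>)\<bar> \<le> 4 / real n"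
proof -
  have "(real n - 2 * real (r n)) / real n - (1 - 2 * \<beta>) = 2 * (\<beta> * real n - real (r n)) / real n"
    using assms by (simp add: field_simps)
  moreover have "\<bar>\<beta> * real n - real (r n)\<bar> \<le> 2"
    using r_lower[of n] r_upper[of n] by simp
  ultimately show ?thesis using assms by (simp add: abs_mult divide_right_mono)
qed

lemma hsphere_mean_deviation_LIMSEQ:
  "(\<lambda>n. mean_deviation n (pmf_of_set (hsphere n (r n))) (1 - 2 * \<beta>)) \<longlonglongrightarrow> 0"
proof (rule tendsto_sandwich[OF _ _ tendsto_const lim_const_over_n])
  show "\<forall>\<^sub>F n in sequentially. mean_deviation n (pmf_of_set (hsphere n (r n))) (1 - 2 * \<beta>) \<le> 4 / real n"
    using eventually_ge_at_top[of 2]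
    by eventually_elim (simp add: hsphere_mean_deviation radius_bounds(2) radius_deviation)
qed (auto simp: mean_deviation_nonneg)

lemma sqrt_over_LIMSEQ: "(\<lambda>n. 4 / real n + sqrt (5 * real n) / real n) \<longlonglongrightarrow> 0"
  by real_asymp

lemma hball_mean_deviation_LIMSEQ:
  "(\<lambda>n. mean_deviation n (pmf_of_set (hball n (r n))) (1 - 2 * \<beta>)) \<longlonglongrightarrow> 0"
proof (rule tendsto_sandwich[OF _ _ tendsto_const sqrt_over_LIMSEQ])
  show "\<forall>\<^sub>F n in sequentially. mean_deviation n (pmf_of_set (hball n (r n))) (1 - 2 * \<beta>) \<le>
      4 / real n + sqrt (5 * real n) / real n"
    using eventually_ge_at_top[of 2]
  proof eventually_elim
    case (elim n)
    then have "n > 0" by simp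
    have "(ball_bias n (r n) - (real n - 2 * real (r n))) / real n \<le> sqrt (5 * real n) / real n"
      by (intro divide_right_mono ball_bias_bounds(2) radius_bounds elim) simp
    then show ?case
      using hball_mean_deviation[of n "r n" "1 - 2 * \<beta>"] radius_deviation[OF \<open>n > 0\<close>] by linarith
  qed
qed (auto simp: mean_deviation_nonneg)

text \<open>The bias exceeds \<open>n - 2 * r\<close> by at most order \<open>sqrt n\<close>, and
  \<open>n - 2 * r\<close> divided by \<open>n\<close> tends to the claimed value. Up to sign this
  is the limit of the parity means of the balls.\<close>

lemma ball_bias_LIMSEQ: "(\<lambda>n. ball_bias n (r n) / real n) \<longlonglongrightarrow> 1 - 2 * \<beta>"
proof (rule LIM_zero_cancel, rule Lim_null_comparison[OF _ sqrt_over_LIMSEQ])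
  show "\<forall>\<^sub>F n in sequentially. norm (ball_bias n (r n) / real n - (1 - 2 * \<beta>)) \<le>
      4 / real n + sqrt (5 * real n) / real n"
    using eventually_ge_at_top[of 2]
  proof eventually_elim
    case (elim n)
    then have "n > 0" by simp
    let ?d = "ball_bias n (r n) - (real n - 2 * real (r n))"
    have "?d / real n \<le> sqrt (5 * real n) / real n"
      by (intro divide_right_mono ball_bias_bounds(2) radius_bounds elim) simp
    moreover have "?d / real n \<ge> 0"
      using ball_bias_bounds(1)[OF radius_bounds(1) radius_bounds(2)[OF elim]] by simp
    moreover have "ball_bias n (r n) / real n - (1 - 2 * \<beta>) =
        ((real n - 2 * real (r n)) / real n - (1 - 2 * \<beta>)) + ?d / real n"
      by (simp add: diff_divide_distrib)
    ultimately show ?case using radius_deviation[OF \<open>n > 0\<close>] by simp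
  qed
qed

end

section \<open>Even and odd radii, and the final assembly\<close>

lemma even_radius_bounds:
  assumes "0 \<le> \<beta>"
  shows "\<beta> * real n - 2 \<le> real (even_radius \<beta> n)" "real (even_radius \<beta> n) \<le> \<beta> * real n"
proof -
  have "0 \<le> \<beta> * real n / 2" using assms by simp
  then have "real (nat \<lfloor>\<beta> * real n / 2\<rfloor>) = of_int \<lfloor>\<beta> * real n / 2\<rfloor>" by simp
  then show "\<beta> * real n - 2 \<le> real (even_radius \<beta> n)" "real (even_radius \<beta> n) \<le> \<beta> * real n"
    unfolding even_radius_def by linarith+
qed

lemma odd_radius_eq: "odd_radius \<beta> n = even_radius \<beta> n + 1"
  by (simp add: odd_radius_def even_radius_def)

lemma even_even_radius: "even (even_radius \<beta> n)"
  by (simp add: even_radius_def)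

lemma odd_odd_radius: "odd (odd_radius \<beta> n)"
  by (simp add: odd_radius_eq even_even_radius)

theorem theorem5:
  fixes \<alpha> \<beta> :: real
  assumes "0 < \<alpha>" "\<alpha> \<le> 1 / 2"
    and "0 < \<beta>" "\<beta> \<le> 1 / 2"
  shows "convergent (\<lambda>n. GammaN_S n (vol \<alpha> n) (odd_radius \<beta> n)) \<and>
    convergent (\<lambda>n. GammaN_B n (vol \<alpha> n) (odd_radius \<beta> n)) \<and>
    Gamma_odd_S \<alpha> \<beta> = Gamma_odd_B \<alpha> \<beta> \<and>
    Gamma_odd_B \<alpha> \<beta> = Gamma_IID \<alpha> \<beta> \<and>
    ereal (max (Gamma_IID \<alpha> \<beta>) (1 / 2 * Gamma_IID (2 * \<alpha>) \<beta>)) \<le> Gamma_even_S_lower \<alpha> \<beta> \<and>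
    Gamma_even_S_lower \<alpha> \<beta> \<le> Gamma_even_S_upper \<alpha> \<beta> \<and>
    Gamma_even_S_upper \<alpha> \<beta> \<le> ereal (2 * Gamma_IID \<alpha> \<beta>) \<and>
    ereal (Gamma_IID \<alpha> \<beta>) \<le> Gamma_even_B_lower \<alpha> \<beta> \<and>
    Gamma_even_B_lower \<alpha> \<beta> \<le> Gamma_even_B_upper \<alpha> \<beta> \<and>
    Gamma_even_B_upper \<alpha> \<beta> \<le> ereal (2 * (1 - \<beta>) * Gamma_IID \<alpha> \<beta>)"
proof -
  have \<beta>: "0 < \<beta>" "\<beta> \<le> 1 / 2" by fact+
  have odd_lower: "\<beta> * real n - 2 \<le> real (odd_radius \<beta> n)"
    and odd_upper: "real (odd_radius \<beta> n) \<le> \<beta> * real n + 1"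
    and even_lower: "\<beta> * real n - 2 \<le> real (even_radius \<beta> n)"
    and even_upper: "real (even_radius \<beta> n) \<le> \<beta> * real n + 1" for n
    using even_radius_bounds[of \<beta> n] \<beta> by (auto simp: odd_radius_eq)
  have odd_le: "\<forall>\<^sub>F n in sequentially. odd_radius \<beta> n \<le> n"
    using eventually_ge_at_top[of 2] by eventually_elim (rule radius_bounds(2)[OF odd_lower odd_upper \<beta>])
  have even_le: "\<forall>\<^sub>F n in sequentially. even_radius \<beta> n \<le> n"
    using eventually_ge_at_top[of 2] by eventually_elim (rule radius_bounds(2)[OF even_lower even_upper \<beta>])

  interpret SO: noise_sequence "\<lambda>n. pmf_of_set (hsphere n (odd_radius \<beta> n))" \<alpha> \<beta>
    by unfold_locales
       (use assms odd_le in \<open>auto intro: hsphere_mean_deviation_LIMSEQ[OF odd_lower odd_upper \<beta>]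
          elim: eventually_mono exchangeable_hsphere\<close>)
  interpret SE: noise_sequence "\<lambda>n. pmf_of_set (hsphere n (even_radius \<beta> n))" \<alpha> \<beta>
    by unfold_locales
       (use assms even_le in \<open>auto intro: hsphere_mean_deviation_LIMSEQ[OF even_lower even_upper \<beta>]
          elim: eventually_mono exchangeable_hsphere\<close>)
  interpret BO: noise_sequence "\<lambda>n. pmf_of_set (hball n (odd_radius \<beta> n))" \<alpha> \<beta>
    by unfold_locales
       (use assms in \<open>auto simp: exchangeable_hball
          intro: hball_mean_deviation_LIMSEQ[OF odd_lower odd_upper \<beta>]\<close>)
  interpret BE: noise_sequence "\<lambda>n. pmf_of_set (hball n (even_radius \<beta> n))" \<alpha> \<beta>
    by unfold_locales
       (use assms in \<open>auto simp: exchangeable_hball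
          intro: hball_mean_deviation_LIMSEQ[OF even_lower even_upper \<beta>]\<close>)

  have "\<forall>\<^sub>F n in sequentially. SO.parity_mean n = -1"
    using odd_le by eventually_elim (simp add: hsphere_parity odd_odd_radius)
  then have SO_parity: "SO.parity_mean \<longlonglongrightarrow> -1" by (rule tendsto_eventually)
  have SE_parity_eq: "\<forall>\<^sub>F n in sequentially. SE.parity_mean n = 1"
    using even_le by eventually_elim (simp add: hsphere_parity even_even_radius)
  then have SE_parity: "SE.parity_mean \<longlonglongrightarrow> 1" by (rule tendsto_eventually)
  \<comment> \<open>For odd radii the parity mean of the ball is minus the normalised bias. Its
    limit is nonpositive because \<open>\<beta> \<le> 1 / 2\<close>, which is what convergence of
    the maxima requires.\<close>
  have "\<forall>\<^sub>F n in sequentially. BO.parity_mean n = - (ball_bias n (odd_radius \<beta> n) / real n)"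
    using eventually_gt_at_top[of 0] by eventually_elim (simp add: hball_parity odd_odd_radius)
  then have BO_parity: "BO.parity_mean \<longlonglongrightarrow> - (1 - 2 * \<beta>)"
    by (rule tendsto_cong[THEN iffD2])
       (rule tendsto_minus[OF ball_bias_LIMSEQ[OF odd_lower odd_upper \<beta>]])
  have "\<forall>\<^sub>F n in sequentially. BE.parity_mean n = ball_bias n (even_radius \<beta> n) / real n"
    using eventually_gt_at_top[of 0] by eventually_elim (simp add: hball_parity even_even_radius)
  then have BE_parity: "BE.parity_mean \<longlonglongrightarrow> 1 - 2 * \<beta>"
    by (rule tendsto_cong[THEN iffD2]) (rule ball_bias_LIMSEQ[OF even_lower even_upper \<beta>])

  have S: "(\<lambda>n. GammaN_S n (vol \<alpha> n) (odd_radius \<beta> n)) \<longlonglongrightarrow> Gamma_IID \<alpha> \<beta>"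
    unfolding GammaN_S_eq by (rule SO.max_stab_LIMSEQ[OF SO_parity]) simp
  have B: "(\<lambda>n. GammaN_B n (vol \<alpha> n) (odd_radius \<beta> n)) \<longlonglongrightarrow> Gamma_IID \<alpha> \<beta>"
    unfolding GammaN_B_eq by (rule BO.max_stab_LIMSEQ[OF BO_parity]) (use \<beta> in simp)
  have "ereal (Gamma_IID \<alpha> \<beta>) \<le> Gamma_even_S_lower \<alpha> \<beta>"
    unfolding Gamma_even_S_lower_def GammaN_S_eq by (rule le_liminf_ereal[OF SE.max_stab_lower])
  \<comment> \<open>Only even spheres have parity mean equal to 1, so this second lower bound has no
    counterpart for balls below.\<close>
  moreover have "ereal (1 / 2 * Gamma_IID (2 * \<alpha>) \<beta>) \<le> Gamma_even_S_lower \<alpha> \<beta>"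
    unfolding Gamma_even_S_lower_def GammaN_S_eq
    by (rule le_liminf_ereal[OF SE.max_stab_lower_even[OF SE_parity_eq]])
  ultimately have S_lower:
    "ereal (max (Gamma_IID \<alpha> \<beta>) (1 / 2 * Gamma_IID (2 * \<alpha>) \<beta>)) \<le> Gamma_even_S_lower \<alpha> \<beta>"
    by (simp add: max_def)
  have B_lower: "ereal (Gamma_IID \<alpha> \<beta>) \<le> Gamma_even_B_lower \<alpha> \<beta>"
    unfolding Gamma_even_B_lower_def GammaN_B_eq by (rule le_liminf_ereal[OF BE.max_stab_lower])
  have "Gamma_even_S_upper \<alpha> \<beta> \<le> ereal ((1 + max 0 1) * Gamma_IID \<alpha> \<beta>)"
    unfolding Gamma_even_S_upper_def GammaN_S_eq
    by (rule limsup_le_ereal[OF SE.max_stab_upper_limit[OF SE_parity]])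
  then have S_upper: "Gamma_even_S_upper \<alpha> \<beta> \<le> ereal (2 * Gamma_IID \<alpha> \<beta>)" by simp
  have "Gamma_even_B_upper \<alpha> \<beta> \<le> ereal ((1 + max 0 (1 - 2 * \<beta>)) * Gamma_IID \<alpha> \<beta>)"
    unfolding Gamma_even_B_upper_def GammaN_B_eq
    by (rule limsup_le_ereal[OF BE.max_stab_upper_limit[OF BE_parity]])
  moreover have "1 + max 0 (1 - 2 * \<beta>) = 2 * (1 - \<beta>)" using \<beta> by simp
  ultimately have B_upper: "Gamma_even_B_upper \<alpha> \<beta> \<le> ereal (2 * (1 - \<beta>) * Gamma_IID \<alpha> \<beta>)"
    by simp
  have "Gamma_even_S_lower \<alpha> \<beta> \<le> Gamma_even_S_upper \<alpha> \<beta>"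
    and "Gamma_even_B_lower \<alpha> \<beta> \<le> Gamma_even_B_upper \<alpha> \<beta>"
    unfolding Gamma_even_S_lower_def Gamma_even_S_upper_def Gamma_even_B_lower_def Gamma_even_B_upper_def
    by (rule Liminf_le_Limsup, simp)+
  moreover have "Gamma_odd_S \<alpha> \<beta> = Gamma_IID \<alpha> \<beta>" "Gamma_odd_B \<alpha> \<beta> = Gamma_IID \<alpha> \<beta>"
    unfolding Gamma_odd_S_def Gamma_odd_B_def using S B by (auto intro: limI)
  ultimately show ?thesis
    using convergentI[OF S] convergentI[OF B] S_lower S_upper B_lower B_upper by auto
qed

end
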